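(* Let $a,b>0$ and let $g:\mathbb{R}\to\mathbb{C}$ be a measurable function. The following are equivalent: (1) $g\in L^2(\mathbb{R})$. (2) The WH-frame Identity (for the system $(g,a,b)$) holds for all bounded, compactly supported (measurable) functions $f$ on $\mathbb{R}$.
   Context: For $c\in\mathbb{R}$ let $T_cf(x)=f(x-c)$ and $E_cf(x)=e^{2\pi i c x}f(x)$. Write $\langle f,h\rangle=\int_{\mathbb{R}}f\overline{h}$. For $k\in\mathbb{Z}$ put $G_k(t)=\sum_{n\in\mathbb{Z}}g(t-na)\overline{g(t-na-k/b)}$; in particular $G_0(t)=\sum_{n}|g(t-na)|^2$. The WH-frame Identity for $f$ is $$\sum_{m,n\in\mathbb{Z}}|\langle f,E_{mb}T_{na}g\rangle|^2=\frac1b\sum_{k\in\mathbb{Z}}\int_{\mathbb{R}}\overline{f(t)}f(t-k/b)G_k(t)\,dt .$$ The WH-frame Identity "holds for $f$" means: the series on the left sums to a finite number and is equal to the series on the right, which converges unconditionally. This includes that all terms are well defined and finite: the integrals defining $\langle f,E_{mb}T_{na}g\rangle$ converge absolutely, and for each $k$ the integrand $\overline{f(t)}f(t-k/b)G_k(t)$ is integrable, where the integrand is taken to be $0$ where $\overline{f(t)}f(t-k/b)=0$ and the sum defining $G_k(t)$ converges absolutely for almost every other $t$. *)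

theory Defs
  imports "HOL-Analysis.Analysis"
begin

text \<open>Measurability and integration are with respect to Lebesgue measure \<^term>\<open>lebesgue\<close>
  (not only Borel sets). Elements of L2 are represented by functions rather than by
  almost-everywhere classes.\<close>

definition L2_functions :: "(real \<Rightarrow> complex) set" where
  "L2_functions =
     {f. f \<in> borel_measurable lebesgue \<and> integrable lebesgue (\<lambda>x. (cmod (f x))\<^sup>2)}"

definition bounded_compactly_supported :: "(real \<Rightarrow> complex) \<Rightarrow> bool" where
  "bounded_compactly_supported f \<longleftrightarrow>
     f \<in> borel_measurable lebesgue \<and> bounded (range f) \<and> compact (closure (support_on UNIV f))"

definition translation :: "real \<Rightarrow> (real \<Rightarrow> complex) \<Rightarrow> (real \<Rightarrow> complex)" where
  "translation c f = (\<lambda>x. f (x - c))"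

definition modulation :: "real \<Rightarrow> (real \<Rightarrow> complex) \<Rightarrow> (real \<Rightarrow> complex)" where
  "modulation c f = (\<lambda>x. exp (2 * complex_of_real pi * \<i> * complex_of_real (c * x)) * f x)"

definition pairing :: "(real \<Rightarrow> complex) \<Rightarrow> (real \<Rightarrow> complex) \<Rightarrow> complex" where
  "pairing f h = (\<integral>x. f x * cnj (h x) \<partial>lebesgue)"

definition WH_atom :: "(real \<Rightarrow> complex) \<Rightarrow> real \<Rightarrow> real \<Rightarrow> int \<Rightarrow> int \<Rightarrow> (real \<Rightarrow> complex)" where
  "WH_atom g a b m n = modulation (of_int m * b) (translation (of_int n * a) g)"

definition G_term :: "(real \<Rightarrow> complex) \<Rightarrow> real \<Rightarrow> real \<Rightarrow> int \<Rightarrow> real \<Rightarrow> int \<Rightarrow> complex" where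
  "G_term g a b k t n = g (t - of_int n * a) * cnj (g (t - of_int n * a - of_int k / b))"

definition G :: "(real \<Rightarrow> complex) \<Rightarrow> real \<Rightarrow> real \<Rightarrow> int \<Rightarrow> real \<Rightarrow> complex" where
  "G g a b k t = (\<Sum>\<^sub>\<infinity>n\<in>UNIV. G_term g a b k t n)"

definition f_product :: "(real \<Rightarrow> complex) \<Rightarrow> real \<Rightarrow> int \<Rightarrow> real \<Rightarrow> complex" where
  "f_product f b k t = cnj (f t) * f (t - of_int k / b)"

text \<open>Unconditional convergence of the two series is \<^const>\<open>summable_on\<close>. Where
  \<^term>\<open>f_product f b k t\<close> vanishes, \<^term>\<open>f_product f b k t * G g a b k t\<close> is \<open>0\<close> whether or
  not the series defining \<^const>\<open>G\<close> converges there, since \<^const>\<open>infsum\<close> is total.\<close>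

definition WH_frame_identity_holds ::
    "(real \<Rightarrow> complex) \<Rightarrow> real \<Rightarrow> real \<Rightarrow> (real \<Rightarrow> complex) \<Rightarrow> bool" where
  "WH_frame_identity_holds g a b f \<longleftrightarrow>
     (\<forall>m n. integrable lebesgue (\<lambda>x. f x * cnj (WH_atom g a b m n x))) \<and>
     (\<forall>k. AE t in lebesgue. f_product f b k t \<noteq> 0 \<longrightarrow>
            Infinite_Sum.abs_summable_on (G_term g a b k t) UNIV) \<and>
     (\<forall>k. integrable lebesgue (\<lambda>t. f_product f b k t * G g a b k t)) \<and>
     (\<lambda>(m, n). (cmod (pairing f (WH_atom g a b m n)))\<^sup>2) summable_on UNIV \<and>
     (\<lambda>k. \<integral>t. f_product f b k t * G g a b k t \<partial>lebesgue) summable_on UNIV \<and>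
     complex_of_real (\<Sum>\<^sub>\<infinity>(m, n)\<in>UNIV. (cmod (pairing f (WH_atom g a b m n)))\<^sup>2) =
       1 / complex_of_real b * (\<Sum>\<^sub>\<infinity>k\<in>UNIV. \<integral>t. f_product f b k t * G g a b k t \<partial>lebesgue)"

end

theory Submission
  imports Defs
begin

text \<open>
  Fix a bounded \<open>f\<close> with compact support and put \<open>h t = f t * cnj (g (t - n a))\<close>. The inner product
  of \<open>f\<close> with the atom of index \<open>(m, n)\<close> is the Fourier integral of \<open>h\<close> at the frequency \<open>m b\<close>. If
  \<open>g\<close> is square-integrable, so is \<open>h\<close>, and this Fourier integral is also a Fourier coefficient of
  the periodization of \<open>h\<close> with period \<open>1 / b\<close>, a finite sum of translates. Parseval's identity
  (\<open>parseval_period\<close>) thus evaluates the sum over \<open>m\<close>, and unfolding the integral over one period to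
  the whole line turns the result into \<open>1 / b\<close> times the sum over \<open>k\<close> of the integrals of
  \<open>cnj (h t) * h (t - k / b)\<close> (\<open>parseval_bounded_support\<close>). These integrands are
  \<open>f_product f b k t * G_term g a b k t n\<close>, so that summing over \<open>n\<close> yields the frame identity. The
  interchange of this sum with the integral is justified by the fact that the translates by \<open>n a\<close> of a
  bounded interval overlap boundedly often (\<open>sum_integral_translates_le\<close>); only finitely many \<open>k\<close>
  contribute because \<open>f\<close> has bounded support.

  Parseval's identity on a period comes from the density of the trigonometric polynomials in \<open>L\<^sup>2\<close>.
  The Stone-Weierstrass theorem on the unit circle gives uniform approximation of continuous periodic
  functions; these approximate bounded measurable functions, and these in turn approximate all
  square-integrable functions (\<open>trig_approximable_L2\<close>).

  For the converse, one test function is enough: let \<open>f\<close> be the indicator of \<open>[0, a)\<close>. The term \<open>k = 0\<close>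
  on the right is the integral over \<open>[0, a)\<close> of the periodization \<open>G_0\<close> of \<open>|g|\<^sup>2\<close>, and its
  finiteness is the finiteness of \<open>\<integral> |g|\<^sup>2\<close> (\<open>L2_of_WH_frame_identity\<close>).
\<close>

section \<open>Harmonics on one period\<close>

definition harmonic :: "real \<Rightarrow> int \<Rightarrow> real \<Rightarrow> complex" where
  "harmonic b m t = exp (2 * complex_of_real pi * \<i> * complex_of_real (of_int m * b * t))"

lemma norm_harmonic [simp]: "cmod (harmonic b m t) = 1"
  by (simp add: harmonic_def)

lemma harmonic_add: "harmonic b (m + n) t = harmonic b m t * harmonic b n t"
  by (simp add: harmonic_def algebra_simps flip: exp_add)

lemma harmonic_0 [simp]: "harmonic b 0 t = 1"
  by (simp add: harmonic_def)

lemma harmonic_cnj: "cnj (harmonic b m t) = harmonic b (- m) t"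
  by (simp add: harmonic_def exp_cnj)

lemma harmonic_shift:
  assumes "b > 0"
  shows "harmonic b m (t - of_int k / b) = harmonic b m t"
proof -
  have "2 * complex_of_real pi * \<i> * complex_of_real (of_int m * b * (t - of_int k / b))
      = 2 * complex_of_real pi * \<i> * complex_of_real (of_int m * b * t)
        + complex_of_real (of_int (2 * (- (m * k))) * pi) * \<i>"
    using assms by (simp add: field_simps)
  then show ?thesis
    unfolding harmonic_def exp_eq by blast
qed

lemma continuous_on_harmonic [continuous_intros]: "continuous_on S (harmonic b m)"
  unfolding harmonic_def by (intro continuous_intros)

lemma harmonic_measurable [measurable]: "harmonic b m \<in> borel_measurable lebesgue"
proof -
  have "harmonic b m \<in> borel_measurable borel"
    by (intro borel_measurable_continuous_onI continuous_on_harmonic)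
  then show ?thesis
    by (simp add: measurable_completion)
qed

text \<open>The harmonics of frequency \<open>m b\<close> have common period \<open>1 / b\<close>. The half-open interval is taken as
  the period, so that its translates by multiples of \<open>1 / b\<close> partition the line.\<close>

definition period_measure :: "real \<Rightarrow> real measure" where
  "period_measure b = lebesgue_on {0..<1/b}"

lemma space_period_measure [simp]: "space (period_measure b) = {0..<1/b}"
  by (simp add: period_measure_def)

lemma finite_period_measure: "finite_measure (period_measure b)"
  unfolding period_measure_def by (rule finite_measure_lebesgue_on) (simp add: bounded_set_imp_lmeasurable)

lemma measurable_period_measure [measurable (raw)]:
  "f \<in> borel_measurable lebesgue \<Longrightarrow> f \<in> borel_measurable (period_measure b)"
  by (simp add: period_measure_def measurable_restrict_space1)

lemma measurable_harmonic_period [measurable]: "harmonic b' m \<in> borel_measurable (period_measure b)"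
  by simp

text \<open>For \<open>m \<noteq> 0\<close> the harmonic has an antiderivative with the same period, so its integral over a period
  is zero.\<close>

lemma harmonic_orthogonal:
  assumes "b > 0"
  shows "(\<integral>t. harmonic b m t \<partial>period_measure b) = (if m = 0 then 1 / of_real b else 0)"
proof (cases "m = 0")
  case True
  then show ?thesis
    using assms by (simp add: period_measure_def measure_restrict_space scaleR_conv_of_real)
next
  case False
  define w where "w = 2 * complex_of_real pi * \<i> * complex_of_real (of_int m * b)"
  have w: "w \<noteq> 0"
    using False assms by (simp add: w_def)
  have h: "harmonic b m t = exp (w * of_real t)" for t
    by (simp add: harmonic_def w_def algebra_simps)
  have hi: "(harmonic b m has_integral (exp (w * of_real (1/b)) / w - exp (w * of_real 0) / w)) {0..1/b}"
  proof (rule fundamental_theorem_of_calculus)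
    fix t assume "t \<in> {0..1/b}"
    have "((\<lambda>z. exp (w * z) / w) has_field_derivative exp (w * of_real t)) (at (of_real t) within UNIV)"
      using w by (auto intro!: derivative_eq_intros)
    then have "((\<lambda>x. exp (w * of_real x) / w) has_vector_derivative exp (w * of_real t)) (at t within {0..1/b})"
      by (intro has_vector_derivative_real_field) auto
    then show "((\<lambda>x. exp (w * of_real x) / w) has_vector_derivative harmonic b m t) (at t within {0..1/b})"
      by (simp add: h)
  qed (use assms in auto)
  have "exp (w * of_real (1/b)) = harmonic b m (0 - of_int (-1) / b)"
    by (simp add: h)
  also have "\<dots> = harmonic b m 0"
    by (rule harmonic_shift[OF assms])
  also have "\<dots> = exp (w * of_real 0)"
    by (simp add: h)
  finally have "(harmonic b m has_integral 0) {0..1/b}"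
    using hi by simp
  then have "integral {0..<1/b} (harmonic b m) = 0"
  proof (subst integral_spike_set[where T = "{0..1/b}"])
    show "negligible {t \<in> {0..<1/b} - {0..1/b}. harmonic b m t \<noteq> 0}"
      "negligible {t \<in> {0..1/b} - {0..<1/b}. harmonic b m t \<noteq> 0}"
      by (rule negligible_subset[OF negligible_sing[of "1/b"]], force)+
  qed (simp add: integral_unique)
  moreover have "integrable (period_measure b) (harmonic b m)"
    by (rule finite_measure.integrable_const_bound[OF finite_period_measure, of _ 1])
       (simp_all add: measurable_harmonic_period)
  then have "(\<integral>t. harmonic b m t \<partial>period_measure b) = integral {0..<1/b} (harmonic b m)"
    unfolding period_measure_def by (rule lebesgue_integral_eq_integral) simp
  ultimately show ?thesis
    using False by simp
qed

section \<open>Square-integrable functions\<close>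

text \<open>Square integrability is carried as a plain pair of hypotheses (measurability and integrability of
  the squared modulus) over an arbitrary measure, so that the same closure properties serve both on
  one period and on the whole line. Products are controlled by \<open>u v \<le> u\<^sup>2 + v\<^sup>2\<close>, sums by
  \<open>|u + v|\<^sup>2 \<le> 2 |u|\<^sup>2 + 2 |v|\<^sup>2\<close>.\<close>

lemma L2_mult_integrable:
  fixes f g :: "'a \<Rightarrow> complex"
  assumes [measurable]: "f \<in> borel_measurable M" "g \<in> borel_measurable M"
    and "integrable M (\<lambda>x. (cmod (f x))\<^sup>2)" "integrable M (\<lambda>x. (cmod (g x))\<^sup>2)"
  shows "integrable M (\<lambda>x. f x * g x)"
proof (rule Bochner_Integration.integrable_bound)
  show "integrable M (\<lambda>x. (cmod (f x))\<^sup>2 + (cmod (g x))\<^sup>2)"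
    using assms by simp
  have "u * v \<le> u\<^sup>2 + v\<^sup>2" if "u \<ge> 0" "v \<ge> 0" for u v :: real
    using that sum_squares_bound[of u v] mult_nonneg_nonneg[of u v] by linarith
  then show "AE x in M. norm (f x * g x) \<le> norm ((cmod (f x))\<^sup>2 + (cmod (g x))\<^sup>2)"
    by (simp add: norm_mult)
qed measurable

lemma cmod_add_square_le: "(cmod (u + v))\<^sup>2 \<le> 2 * (cmod u)\<^sup>2 + 2 * (cmod v)\<^sup>2"
proof -
  have "(cmod (u + v))\<^sup>2 \<le> (cmod u + cmod v)\<^sup>2"
    by (intro power_mono norm_triangle_ineq) simp
  then show ?thesis
    using sum_squares_bound[of "cmod u" "cmod v"] by (simp add: power2_sum)
qed

lemma L2_add_integrable:
  fixes f g :: "'a \<Rightarrow> complex"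
  assumes [measurable]: "f \<in> borel_measurable M" "g \<in> borel_measurable M"
    and "integrable M (\<lambda>x. (cmod (f x))\<^sup>2)" "integrable M (\<lambda>x. (cmod (g x))\<^sup>2)"
  shows "integrable M (\<lambda>x. (cmod (f x + g x))\<^sup>2)"
proof (rule Bochner_Integration.integrable_bound)
  show "integrable M (\<lambda>x. 2 * (cmod (f x))\<^sup>2 + 2 * (cmod (g x))\<^sup>2)"
    using assms by simp
qed (use cmod_add_square_le in \<open>auto intro: order_trans\<close>)

lemma L2_diff_integrable:
  fixes f g :: "'a \<Rightarrow> complex"
  assumes "f \<in> borel_measurable M" "g \<in> borel_measurable M"
    and "integrable M (\<lambda>x. (cmod (f x))\<^sup>2)" "integrable M (\<lambda>x. (cmod (g x))\<^sup>2)"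
  shows "integrable M (\<lambda>x. (cmod (f x - g x))\<^sup>2)"
  using L2_add_integrable[of f M "\<lambda>x. - g x"] assms by simp

lemma L2_sum_integrable:
  fixes f :: "'i \<Rightarrow> 'a \<Rightarrow> complex"
  assumes "finite S"
    and "\<And>i. i \<in> S \<Longrightarrow> f i \<in> borel_measurable M"
    and "\<And>i. i \<in> S \<Longrightarrow> integrable M (\<lambda>x. (cmod (f i x))\<^sup>2)"
  shows "integrable M (\<lambda>x. (cmod (\<Sum>i\<in>S. f i x))\<^sup>2)"
  using assms
proof (induction S)
  case (insert i S)
  then show ?case
    by (simp add: L2_add_integrable borel_measurable_sum)
qed simp

section \<open>Uniform approximation by trigonometric polynomials\<close>

definition trig_polynomial :: "real \<Rightarrow> (real \<Rightarrow> complex) \<Rightarrow> bool" where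
  "trig_polynomial b p \<longleftrightarrow>
     (\<exists>S c. finite S \<and> p = (\<lambda>t. \<Sum>m\<in>S. c m * harmonic b m t))"

lemma trig_polynomial_monomial: "trig_polynomial b (\<lambda>t. c * harmonic b m t)"
  unfolding trig_polynomial_def by (rule exI[of _ "{m}"], rule exI[of _ "\<lambda>_. c"]) simp

lemma trig_polynomial_const: "trig_polynomial b (\<lambda>t. c)"
  using trig_polynomial_monomial[of b c 0] by simp

lemma trig_polynomial_add:
  assumes "trig_polynomial b p" "trig_polynomial b q"
  shows "trig_polynomial b (\<lambda>t. p t + q t)"
proof -
  obtain S c T d where S: "finite S" "p = (\<lambda>t. \<Sum>m\<in>S. c m * harmonic b m t)"
    and T: "finite T" "q = (\<lambda>t. \<Sum>m\<in>T. d m * harmonic b m t)"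
    using assms unfolding trig_polynomial_def by blast
  have "p = (\<lambda>t. \<Sum>m\<in>S \<union> T. (if m \<in> S then c m else 0) * harmonic b m t)"
    unfolding S(2) by (intro ext sum.mono_neutral_cong_left) (use S(1) T(1) in auto)
  moreover have "q = (\<lambda>t. \<Sum>m\<in>S \<union> T. (if m \<in> T then d m else 0) * harmonic b m t)"
    unfolding T(2) by (intro ext sum.mono_neutral_cong_left) (use S(1) T(1) in auto)
  ultimately have "(\<lambda>t. p t + q t) = (\<lambda>t. \<Sum>m\<in>S \<union> T.
      ((if m \<in> S then c m else 0) + (if m \<in> T then d m else 0)) * harmonic b m t)"
    by (simp add: sum.distrib distrib_right)
  then show ?thesis
    unfolding trig_polynomial_def using S(1) T(1)
    by (intro exI[of _ "S \<union> T"] exI[of _ "\<lambda>m. (if m \<in> S then c m else 0) + (if m \<in> T then d m else 0)"]) simp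
qed

lemma trig_polynomial_sum:
  assumes "finite S" "\<And>i. i \<in> S \<Longrightarrow> trig_polynomial b (p i)"
  shows "trig_polynomial b (\<lambda>t. \<Sum>i\<in>S. p i t)"
  using assms
  by (induction S) (auto intro: trig_polynomial_add trig_polynomial_const)

lemma trig_polynomial_mult:
  assumes "trig_polynomial b p" "trig_polynomial b q"
  shows "trig_polynomial b (\<lambda>t. p t * q t)"
proof -
  obtain S c T d where S: "finite S" "p = (\<lambda>t. \<Sum>m\<in>S. c m * harmonic b m t)"
    and T: "finite T" "q = (\<lambda>t. \<Sum>m\<in>T. d m * harmonic b m t)"
    using assms unfolding trig_polynomial_def by blast
  have "(\<lambda>t. p t * q t) = (\<lambda>t. \<Sum>m\<in>S. \<Sum>k\<in>T. (c m * d k) * harmonic b (m + k) t)"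
    unfolding S(2) T(2) by (simp add: sum_product harmonic_add mult_ac)
  then show ?thesis
    using S(1) T(1) by (simp add: trig_polynomial_sum trig_polynomial_monomial)
qed

lemma trig_polynomial_measurable:
  "trig_polynomial b p \<Longrightarrow> p \<in> borel_measurable lebesgue"
  unfolding trig_polynomial_def by auto

lemma L2_harmonic: "integrable (period_measure b') (\<lambda>t. (cmod (c * harmonic b m t))\<^sup>2)"
  using finite_measure.integrable_const[OF finite_period_measure]
  by (simp add: norm_mult)

lemma trig_polynomial_L2:
  assumes "trig_polynomial b p"
  shows "integrable (period_measure b) (\<lambda>t. (cmod (p t))\<^sup>2)"
  using assms L2_harmonic unfolding trig_polynomial_def
  by (auto intro!: L2_sum_integrable)

text \<open>On the unit circle a real-linear functional is \<open>z \<mapsto> w z + cnj w cnj z\<close> for some \<open>w\<close>, and conjugation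
  turns the harmonic of index \<open>1\<close> into that of index \<open>-1\<close>. Sums and products preserve trigonometric
  polynomials, so every real polynomial restricted to the circle is one.\<close>

lemma trig_polynomial_of_polynomial:
  assumes "real_polynomial_function (q :: complex \<Rightarrow> real)"
  shows "trig_polynomial b (\<lambda>t. of_real (q (harmonic b 1 t)))"
  using assms
proof induction
  case (linear f)
  interpret bounded_linear f by fact
  have *: "f z = Re z * f 1 + Im z * f \<i>" for z
  proof -
    have "z = Re z *\<^sub>R 1 + Im z *\<^sub>R \<i>"
      by (simp add: complex_eq_iff)
    then have "f z = f (Re z *\<^sub>R 1 + Im z *\<^sub>R \<i>)"
      by (rule arg_cong)
    then show ?thesis
      by (simp only: add scaleR real_scaleR_def)
  qed
  have aux: "of_real (Re z * x + Im z * y) = (of_real x - \<i> * of_real y) / 2 * z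
                      + (of_real x + \<i> * of_real y) / 2 * cnj z" for z and x y :: real
    by (simp add: complex_eq_iff) (simp add: field_simps)
  have f_eq: "of_real (f z) = (of_real (f 1) - \<i> * of_real (f \<i>)) / 2 * z
                      + (of_real (f 1) + \<i> * of_real (f \<i>)) / 2 * cnj z" for z
    using aux[of z "f 1" "f \<i>"] by (simp only: *[of z, symmetric])
  have "(\<lambda>t. complex_of_real (f (harmonic b 1 t))) =
      (\<lambda>t. (of_real (f 1) - \<i> * of_real (f \<i>)) / 2 * harmonic b 1 t
         + (of_real (f 1) + \<i> * of_real (f \<i>)) / 2 * harmonic b (-1) t)"
    by (intro ext, subst f_eq) (simp add: harmonic_cnj)
  then show ?case
    by (simp only: trig_polynomial_add trig_polynomial_monomial)
qed (simp_all add: trig_polynomial_add trig_polynomial_mult trig_polynomial_const)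

text \<open>The harmonic of index \<open>1\<close> maps the closed period onto the circle, gluing the two end points. As a
  continuous surjection from a compact space to a Hausdorff space it is a quotient map, so a
  continuous function with equal end values descends to the circle. This makes the
  Stone-Weierstrass theorem on the circle applicable to periodic functions.\<close>

lemma continuous_on_circle_lift:
  assumes "b > 0" "continuous_on {0..1/b} u" "u 0 = u (1/b)"
  obtains v where "continuous_on (sphere 0 1) v"
    "\<And>t. t \<in> {0..1/b} \<Longrightarrow> v (harmonic b 1 t) = u t"
proof -
  define X where "X = top_of_set {0..1/b}"
  define Y where "Y = top_of_set (sphere (0::complex) 1)"
  \<comment> \<open>A section of the covering: it inverts the harmonic except at the right end point, which it sends to \<open>0\<close>.\<close>
  define s where "s z = Arg2pi z / (2 * pi * b)" for z
  have hs: "harmonic b 1 (s z) = z" if "cmod z = 1" for z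
  proof -
    have "2 * complex_of_real pi * \<i> * complex_of_real (of_int 1 * b * s z) = \<i> * of_real (Arg2pi z)"
      using assms(1) by (simp add: s_def)
    then have "harmonic b 1 (s z) = exp (\<i> * of_real (Arg2pi z))"
      by (simp only: harmonic_def)
    then show ?thesis
      using that complex_norm_eq_1_exp by simp
  qed
  have s_range: "s z \<in> {0..1/b}" for z
  proof -
    have "0 \<le> Arg2pi z" "Arg2pi z \<le> 2 * pi"
      using Arg2pi[of z] by simp_all
    then have "Arg2pi z / (2 * pi * b) \<le> 2 * pi / (2 * pi * b)"
      using assms(1) by (intro divide_right_mono) auto
    then show ?thesis
      using assms(1) \<open>0 \<le> Arg2pi z\<close> by (simp add: s_def)
  qed
  have surj: "harmonic b 1 ` {0..1/b} = sphere 0 1"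
  proof (rule set_eqI, rule iffI)
    fix z :: complex assume "z \<in> sphere 0 1"
    then show "z \<in> harmonic b 1 ` {0..1/b}"
      using hs[of z] s_range[of z] by (intro image_eqI[of _ _ "s z"]) auto
  qed auto
  have q: "quotient_map X Y (harmonic b 1)"
  proof (rule T1_Spaces.continuous_imp_quotient_map)
    show "continuous_map X Y (harmonic b 1)"
      by (auto simp: X_def Y_def continuous_on_harmonic)
  qed (auto simp: X_def Y_def surj compact_space_subtopology Hausdorff_space_subtopology)
  have s_inv: "u (s (harmonic b 1 t)) = u t" if t: "t \<in> {0..1/b}" for t
  proof (cases "t = 1/b")
    case True
    then have "harmonic b 1 t = 1"
      using harmonic_shift[OF assms(1), of 1 "1/b" 1] by (simp add: harmonic_def)
    then show ?thesis
      using True assms(3) by (simp add: s_def Arg2pi_of_real[of 1, simplified])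
  next
    case False
    then have "2 * pi * b * t < 2 * pi"
      using t assms(1) by (simp add: field_simps)
    then have "Arg2pi (harmonic b 1 t) = 2 * pi * b * t"
      using t assms(1) Arg2pi_exp[of "2 * complex_of_real pi * \<i> * complex_of_real (b * t)"]
      by (simp add: harmonic_def mult_ac)
    then show ?thesis
      using assms(1) by (simp add: s_def)
  qed
  have "continuous_map X euclidean ((u \<circ> s) \<circ> harmonic b 1)"
  proof -
    have "continuous_on {0..1/b} ((u \<circ> s) \<circ> harmonic b 1)"
      by (rule continuous_on_eq[OF assms(2)]) (simp add: s_inv)
    then show ?thesis
      by (simp add: X_def)
  qed
  then have "continuous_map Y euclidean (u \<circ> s)"
    by (rule continuous_compose_quotient_map[OF q])
  then have "continuous_on (sphere 0 1) (u \<circ> s)"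
    by (simp add: Y_def)
  with s_inv show ?thesis
    by (intro that[of "u \<circ> s"]) auto
qed

lemma trig_polynomial_uniform_approx_real:
  fixes u :: "real \<Rightarrow> real"
  assumes "b > 0" "continuous_on {0..1/b} u" "u 0 = u (1/b)" "e > 0"
  obtains p where "trig_polynomial b p" "\<And>t. t \<in> {0..1/b} \<Longrightarrow> cmod (of_real (u t) - p t) < e"
proof -
  obtain v where v: "continuous_on (sphere 0 1) v"
    "\<And>t. t \<in> {0..1/b} \<Longrightarrow> v (harmonic b 1 t) = u t"
    using continuous_on_circle_lift[OF assms(1-3)] by blast
  obtain q where q: "real_polynomial_function q" "\<And>z. z \<in> sphere 0 1 \<Longrightarrow> \<bar>v z - q z\<bar> < e"
    using Stone_Weierstrass_real_polynomial_function[OF compact_sphere v(1) assms(4)] by blast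
  show ?thesis
  proof
    show "trig_polynomial b (\<lambda>t. of_real (q (harmonic b 1 t)))"
      by (rule trig_polynomial_of_polynomial[OF q(1)])
    fix t assume "t \<in> {0..1/b}"
    then show "cmod (of_real (u t) - of_real (q (harmonic b 1 t))) < e"
      using q(2)[of "harmonic b 1 t"] v(2)[of t] by (simp flip: of_real_diff)
  qed
qed

lemma trig_polynomial_uniform_approx:
  assumes "b > 0" "continuous_on {0..1/b} u" "u 0 = u (1/b)" "e > 0"
  obtains p where "trig_polynomial b p" "\<And>t. t \<in> {0..1/b} \<Longrightarrow> cmod (u t - p t) < e"
proof -
  obtain p where p: "trig_polynomial b p"
    "\<And>t. t \<in> {0..1/b} \<Longrightarrow> cmod (of_real (Re (u t)) - p t) < e/2"
    using trig_polynomial_uniform_approx_real[of b "\<lambda>t. Re (u t)" "e/2"] assms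
    by (auto intro: continuous_intros)
  obtain q where q: "trig_polynomial b q"
    "\<And>t. t \<in> {0..1/b} \<Longrightarrow> cmod (of_real (Im (u t)) - q t) < e/2"
    using trig_polynomial_uniform_approx_real[of b "\<lambda>t. Im (u t)" "e/2"] assms
    by (auto intro: continuous_intros)
  show ?thesis
  proof
    show "trig_polynomial b (\<lambda>t. p t + \<i> * q t)"
      by (intro trig_polynomial_add trig_polynomial_mult trig_polynomial_const p q)
    fix t assume t: "t \<in> {0..1/b}"
    have "u t - (p t + \<i> * q t) = (of_real (Re (u t)) - p t) + \<i> * (of_real (Im (u t)) - q t)"
      by (subst (1) complex_eq[of "u t"]) (simp add: algebra_simps)
    also have "cmod \<dots> \<le> cmod (of_real (Re (u t)) - p t) + cmod (\<i> * (of_real (Im (u t)) - q t))"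
      by (rule norm_triangle_ineq)
    also have "\<dots> < e"
      using p(2)[OF t] q(2)[OF t] by (simp add: norm_mult)
    finally show "cmod (u t - (p t + \<i> * q t)) < e" .
  qed
qed

section \<open>Completeness of the harmonics and Parseval's identity\<close>

definition trig_approximable :: "real \<Rightarrow> (real \<Rightarrow> complex) \<Rightarrow> bool" where
  "trig_approximable b F \<longleftrightarrow>
     (\<forall>e>0. \<exists>p. trig_polynomial b p \<and> (\<integral>t. (cmod (F t - p t))\<^sup>2 \<partial>period_measure b) < e)"

lemma trig_approximable_continuous:
  assumes "b > 0" "continuous_on {0..1/b} u" "u 0 = u (1/b)"
  shows "trig_approximable b u"
  unfolding trig_approximable_def
proof (intro allI impI)
  fix e :: real assume "e > 0"
  define d where "d = sqrt (e * b / 2)"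
  have d: "d > 0" "d\<^sup>2 / b < e"
    using \<open>e > 0\<close> \<open>b > 0\<close> by (simp_all add: d_def)
  obtain p where p: "trig_polynomial b p" "\<And>t. t \<in> {0..1/b} \<Longrightarrow> cmod (u t - p t) < d"
    using trig_polynomial_uniform_approx[OF assms d(1)] by blast
  have "(\<integral>t. (cmod (u t - p t))\<^sup>2 \<partial>period_measure b) \<le> (\<integral>t. d\<^sup>2 \<partial>period_measure b)"
  proof (rule integral_mono_AE')
    show "integrable (period_measure b) (\<lambda>t. d\<^sup>2)"
      by (rule finite_measure.integrable_const[OF finite_period_measure])
    show "AE t in period_measure b. (cmod (u t - p t))\<^sup>2 \<le> d\<^sup>2"
      using p(2) by (intro AE_I2 power_mono) (auto simp: less_imp_le)
  qed auto
  also have "\<dots> = d\<^sup>2 / b"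
    using assms(1) by (simp add: period_measure_def measure_restrict_space)
  finally show "\<exists>p. trig_polynomial b p \<and> (\<integral>t. (cmod (u t - p t))\<^sup>2 \<partial>period_measure b) < e"
    using p(1) d(2) by (intro exI[of _ p]) linarith
qed

text \<open>An \<open>\<epsilon>/2\<close> argument, in which \<open>|u + v|\<^sup>2 \<le> 2 |u|\<^sup>2 + 2 |v|\<^sup>2\<close>
  takes the place of the triangle inequality for the \<open>L\<^sup>2\<close> norm; hence the quarters.\<close>

lemma trig_approximable_L2_limit:
  assumes F [measurable]: "F \<in> borel_measurable (period_measure b)"
    and F2: "integrable (period_measure b) (\<lambda>t. (cmod (F t))\<^sup>2)"
    and U [measurable]: "\<And>n. U n \<in> borel_measurable (period_measure b)"
    and U2: "\<And>n. integrable (period_measure b) (\<lambda>t. (cmod (U n t))\<^sup>2)"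
    and lim: "(\<lambda>n. \<integral>t. (cmod (F t - U n t))\<^sup>2 \<partial>period_measure b) \<longlonglongrightarrow> 0"
    and app: "\<And>n. trig_approximable b (U n)"
  shows "trig_approximable b F"
  unfolding trig_approximable_def
proof (intro allI impI)
  fix e :: real assume "e > 0"
  have "eventually (\<lambda>n. (\<integral>t. (cmod (F t - U n t))\<^sup>2 \<partial>period_measure b) < e / 4) sequentially"
    using order_tendstoD(2)[OF lim, of "e/4"] \<open>e > 0\<close> by simp
  then obtain n where n: "(\<integral>t. (cmod (F t - U n t))\<^sup>2 \<partial>period_measure b) < e / 4"
    by (auto simp: eventually_sequentially)
  obtain p where p: "trig_polynomial b p" "(\<integral>t. (cmod (U n t - p t))\<^sup>2 \<partial>period_measure b) < e / 4"
    using app[of n] \<open>e > 0\<close> unfolding trig_approximable_def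
    by (meson divide_pos_pos zero_less_numeral)
  note [measurable] = measurable_period_measure[OF trig_polynomial_measurable[OF p(1)]]
  have i1: "integrable (period_measure b) (\<lambda>t. (cmod (F t - U n t))\<^sup>2)"
    by (intro L2_diff_integrable F2 U2) measurable
  have i2: "integrable (period_measure b) (\<lambda>t. (cmod (U n t - p t))\<^sup>2)"
    by (intro L2_diff_integrable trig_polynomial_L2 p(1) U2) measurable
  have "(\<integral>t. (cmod (F t - p t))\<^sup>2 \<partial>period_measure b)
      \<le> (\<integral>t. 2 * (cmod (F t - U n t))\<^sup>2 + 2 * (cmod (U n t - p t))\<^sup>2 \<partial>period_measure b)"
  proof (rule integral_mono_AE')
    show "AE t in period_measure b. (cmod (F t - p t))\<^sup>2
        \<le> 2 * (cmod (F t - U n t))\<^sup>2 + 2 * (cmod (U n t - p t))\<^sup>2"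
      using cmod_add_square_le[of "F t - U n t" "U n t - p t" for t] by (intro AE_I2) simp
  qed (use i1 i2 in auto)
  also have "\<dots> = 2 * (\<integral>t. (cmod (F t - U n t))\<^sup>2 \<partial>period_measure b)
                + 2 * (\<integral>t. (cmod (U n t - p t))\<^sup>2 \<partial>period_measure b)"
    using i1 i2 by simp
  also have "\<dots> < e"
    using n p(2) by simp
  finally show "\<exists>p. trig_polynomial b p \<and> (\<integral>t. (cmod (F t - p t))\<^sup>2 \<partial>period_measure b) < e"
    using p(1) by blast
qed

text \<open>The radial retraction of the plane onto the disc of radius \<open>c\<close>.\<close>

definition clamp_norm :: "real \<Rightarrow> complex \<Rightarrow> complex" where
  "clamp_norm c z = z / of_real (max 1 (cmod z / c))"

lemma norm_clamp_le:
  assumes "c > 0"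
  shows "cmod (clamp_norm c z) \<le> c"
proof -
  have "cmod z \<le> c * max 1 (cmod z / c)"
    using assms by (simp add: max_def field_simps)
  moreover have "max 1 (cmod z / c) > 0" "\<bar>max 1 (cmod z / c)\<bar> = max 1 (cmod z / c)"
    by simp_all
  ultimately show ?thesis
    by (simp add: clamp_norm_def norm_divide pos_divide_le_eq del: max_less_iff_conj less_max_iff_disj)
qed

lemma norm_clamp_le_self: "cmod (clamp_norm c z) \<le> cmod z"
proof -
  have "cmod z * 1 \<le> cmod z * max 1 (cmod z / c)"
    by (intro mult_left_mono) simp_all
  moreover have "max 1 (cmod z / c) > 0" "\<bar>max 1 (cmod z / c)\<bar> = max 1 (cmod z / c)"
    by simp_all
  ultimately show ?thesis
    by (simp add: clamp_norm_def norm_divide pos_divide_le_eq del: max_less_iff_conj less_max_iff_disj)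
qed

lemma clamp_eq: "c > 0 \<Longrightarrow> cmod z \<le> c \<Longrightarrow> clamp_norm c z = z"
  by (simp add: clamp_norm_def max_def)

lemma continuous_on_clamp [continuous_intros]:
  assumes "c > 0" "continuous_on S f"
  shows "continuous_on S (\<lambda>x. clamp_norm c (f x))"
proof -
  have "max 1 (cmod (f x) / c) \<noteq> 0" for x
    using max.cobounded1[of 1 "cmod (f x) / c"] by linarith
  then show ?thesis
    unfolding clamp_norm_def using assms by (intro continuous_intros) auto
qed

lemma clamp_measurable:
  assumes "c > 0"
  shows "clamp_norm c \<in> borel_measurable borel"
  by (rule borel_measurable_continuous_onI) (intro continuous_intros assms)

text \<open>A measurable function is an almost everywhere limit of continuous functions. Retracting these onto
  the disc of radius \<open>c\<close> keeps them bounded without affecting the limit, and multiplying by a ramp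
  that vanishes at both end points and tends to \<open>1\<close> inside the period makes them periodic. Dominated
  convergence then gives convergence in \<open>L\<^sup>2\<close>.\<close>

lemma trig_approximable_bounded:
  assumes b: "b > 0" and c: "c > 0"
    and F [measurable]: "F \<in> borel_measurable (period_measure b)"
    and bound: "\<And>t. cmod (F t) \<le> c"
  shows "trig_approximable b F"
proof -
  have "F measurable_on {0..<1/b}"
    using F by (simp add: measurable_on_iff_borel_measurable period_measure_def)
  then obtain N g where N: "negligible N" and g: "\<And>n. continuous_on UNIV (g n)"
    and lim: "\<And>t. t \<notin> N \<Longrightarrow> (\<lambda>n. g n t) \<longlonglongrightarrow> (if t \<in> {0..<1/b} then F t else 0)"
    unfolding measurable_on_def by blast
  define ramp where "ramp n t = min 1 (real n * max 0 (min t (1/b - t)))" for n t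
  have ramp01: "0 \<le> ramp n t" "ramp n t \<le> 1" for n t
    by (simp_all add: ramp_def)
  define U where "U n t = of_real (ramp n t) * clamp_norm c (g n t)" for n t
  have contU: "continuous_on S (U n)" for n S
    unfolding U_def ramp_def
    by (intro continuous_intros c continuous_on_subset[OF g]) auto
  have U_le: "cmod (U n t) \<le> c" for n t
  proof -
    have "cmod (U n t) \<le> 1 * c"
      unfolding U_def norm_mult using ramp01[of n t] norm_clamp_le[OF c]
      by (intro mult_mono) auto
    then show ?thesis
      by simp
  qed
  have "U n \<in> borel_measurable lebesgue" for n
    using borel_measurable_continuous_onI[OF contU] by (simp add: measurable_completion)
  then have U [measurable]: "U n \<in> borel_measurable (period_measure b)" for n
    by (rule measurable_period_measure)
  have L2_bdd: "integrable (period_measure b) (\<lambda>t. (cmod (u t))\<^sup>2)"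
    if [measurable]: "u \<in> borel_measurable (period_measure b)" and "\<And>t. cmod (u t) \<le> c" for u
    by (rule finite_measure.integrable_const_bound[OF finite_period_measure, of _ "c\<^sup>2"])
       (use that(2) in \<open>auto intro!: power_mono\<close>)
  show ?thesis
  proof (rule trig_approximable_L2_limit[OF F L2_bdd[OF F bound] U L2_bdd[OF U U_le]])
    have "AE t in lebesgue. t \<notin> N"
      using N by (auto simp: negligible_iff_null_sets intro: AE_not_in)
    moreover have "AE t in lebesgue. t \<noteq> 0"
      by (rule AE_completion[OF AE_lborel_singleton])
    ultimately have "AE t in lebesgue. t \<in> {0..<1/b} \<longrightarrow> t \<notin> N \<and> t \<noteq> 0"
      by eventually_elim simp
    then have ae: "AE t in period_measure b. t \<notin> N \<and> t \<noteq> 0"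
      unfolding period_measure_def by (subst AE_restrict_space_iff) simp_all
    have conv: "(\<lambda>n. (cmod (F t - U n t))\<^sup>2) \<longlonglongrightarrow> 0"
      if "t \<in> {0..<1/b}" "t \<notin> N" "t \<noteq> 0" for t
    proof -
      have "isCont (clamp_norm c) (F t)"
        using continuous_on_clamp[OF c, of UNIV "\<lambda>x. x"] by (simp add: continuous_on_eq_continuous_at)
      then have "(\<lambda>n. clamp_norm c (g n t)) \<longlonglongrightarrow> clamp_norm c (F t)"
        using lim[of t] that by (intro isCont_tendsto_compose[of _ "clamp_norm c"]) auto
      moreover have "(\<lambda>n. ramp n t) \<longlonglongrightarrow> 1"
      proof (rule tendsto_eventually)
        define d where "d = min t (1/b - t)"
        have "d > 0"
          using that by (auto simp: d_def)
        obtain m :: nat where m: "1 < real m * d"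
          using reals_Archimedean3[OF \<open>d > 0\<close>] by blast
        have "ramp n t = 1" if "n \<ge> m" for n
        proof -
          have "real m * d \<le> real n * d"
            using that \<open>d > 0\<close> by (intro mult_right_mono) auto
          then have "1 \<le> real n * d"
            using m by linarith
          moreover have "max 0 d = d"
            using \<open>d > 0\<close> by simp
          ultimately show ?thesis
            unfolding ramp_def d_def[symmetric] by (metis min_absorb1)
        qed
        then show "\<forall>\<^sub>F n in sequentially. ramp n t = 1"
          by (auto simp: eventually_sequentially)
      qed
      ultimately have "(\<lambda>n. U n t) \<longlonglongrightarrow> of_real 1 * clamp_norm c (F t)"
        unfolding U_def by (intro tendsto_intros)
      then have "(\<lambda>n. U n t) \<longlonglongrightarrow> F t"
        using clamp_eq[OF c bound] by simp
      then have "(\<lambda>n. (cmod (F t - U n t))\<^sup>2) \<longlonglongrightarrow> (cmod (F t - F t))\<^sup>2"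
        by (intro tendsto_intros)
      then show ?thesis
        by simp
    qed
    have "(\<lambda>n. \<integral>t. (cmod (F t - U n t))\<^sup>2 \<partial>period_measure b) \<longlonglongrightarrow> (\<integral>t. 0 \<partial>period_measure b)"
    proof (rule integral_dominated_convergence)
      show "integrable (period_measure b) (\<lambda>t. (2 * c)\<^sup>2)"
        by (rule finite_measure.integrable_const[OF finite_period_measure])
      show "AE t in period_measure b. (\<lambda>n. (cmod (F t - U n t))\<^sup>2) \<longlonglongrightarrow> 0"
        using ae AE_space[of "period_measure b"]
      proof eventually_elim
        case (elim t)
        then show ?case
          using conv[of t] by simp
      qed
      show "AE t in period_measure b. norm ((cmod (F t - U n t))\<^sup>2) \<le> (2 * c)\<^sup>2" for n
      proof (rule AE_I2)
        fix t
        have "cmod (F t - U n t) \<le> 2 * c"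
          using norm_triangle_ineq4[of "F t" "U n t"] bound[of t] U_le[of n t] by linarith
        then have "(cmod (F t - U n t))\<^sup>2 \<le> (2 * c)\<^sup>2"
          by (intro power_mono) auto
        then show "norm ((cmod (F t - U n t))\<^sup>2) \<le> (2 * c)\<^sup>2"
          by (simp only: real_norm_def abs_power2)
      qed
    qed measurable
    then show "(\<lambda>n. \<integral>t. (cmod (F t - U n t))\<^sup>2 \<partial>period_measure b) \<longlonglongrightarrow> 0"
      by simp
    show "trig_approximable b (U n)" for n
    proof (rule trig_approximable_continuous[OF b contU])
      show "U n 0 = U n (1/b)"
        using b by (simp add: U_def ramp_def)
    qed
  qed
qed

text \<open>Truncating the values of \<open>F\<close> reduces the general case to the bounded one.\<close>

lemma trig_approximable_L2:
  assumes b: "b > 0"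
    and F [measurable]: "F \<in> borel_measurable (period_measure b)"
    and F2: "integrable (period_measure b) (\<lambda>t. (cmod (F t))\<^sup>2)"
  shows "trig_approximable b F"
proof -
  define U where "U n t = clamp_norm (real n + 1) (F t)" for n t
  have U [measurable]: "U n \<in> borel_measurable (period_measure b)" for n
    unfolding U_def by (rule measurable_compose[OF F clamp_measurable]) simp
  have U_le: "cmod (U n t) \<le> cmod (F t)" for n t
    unfolding U_def by (rule norm_clamp_le_self)
  have U2: "integrable (period_measure b) (\<lambda>t. (cmod (U n t))\<^sup>2)" for n
    by (rule Bochner_Integration.integrable_bound[OF F2]) (auto intro!: power_mono U_le)
  show ?thesis
  proof (rule trig_approximable_L2_limit[OF F F2 U U2])
    have "(\<lambda>n. \<integral>t. (cmod (F t - U n t))\<^sup>2 \<partial>period_measure b) \<longlonglongrightarrow> (\<integral>t. 0 \<partial>period_measure b)"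
    proof (rule integral_dominated_convergence)
      show "integrable (period_measure b) (\<lambda>t. 4 * (cmod (F t))\<^sup>2)"
        using F2 by simp
      show "AE t in period_measure b. (\<lambda>n. (cmod (F t - U n t))\<^sup>2) \<longlonglongrightarrow> 0"
      proof (rule AE_I2)
        fix t
        obtain m :: nat where "cmod (F t) \<le> real m"
          using real_arch_simple by blast
        then have "U n t = F t" if "n \<ge> m" for n
          unfolding U_def using that by (intro clamp_eq) (auto intro: order_trans)
        then show "(\<lambda>n. (cmod (F t - U n t))\<^sup>2) \<longlonglongrightarrow> 0"
          by (intro tendsto_eventually eventually_sequentiallyI[of m]) simp
      qed
      show "AE t in period_measure b. norm ((cmod (F t - U n t))\<^sup>2) \<le> 4 * (cmod (F t))\<^sup>2" for n
      proof (rule AE_I2)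
        fix t
        have "cmod (F t - U n t) \<le> 2 * cmod (F t)"
          using norm_triangle_ineq4[of "F t" "U n t"] U_le[of n t] by linarith
        then have "(cmod (F t - U n t))\<^sup>2 \<le> (2 * cmod (F t))\<^sup>2"
          by (intro power_mono) auto
        then show "norm ((cmod (F t - U n t))\<^sup>2) \<le> 4 * (cmod (F t))\<^sup>2"
          by (simp add: power_mult_distrib)
      qed
    qed measurable
    then show "(\<lambda>n. \<integral>t. (cmod (F t - U n t))\<^sup>2 \<partial>period_measure b) \<longlonglongrightarrow> 0"
      by simp
    show "trig_approximable b (U n)" for n
      by (rule trig_approximable_bounded[OF b _ U, of "real n + 1"])
         (auto simp: U_def intro!: norm_clamp_le)
  qed
qed

text \<open>The Pythagorean identity behind best approximation: by orthogonality the squared distance from \<open>F\<close>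
  to a trigonometric polynomial is the defect in Bessel's inequality plus a term that vanishes
  exactly when the coefficients are the Fourier coefficients \<open>b I m\<close> of \<open>F\<close>.\<close>

lemma integral_square_distance_trig_polynomial:
  fixes d :: "int \<Rightarrow> complex"
  assumes b: "b > 0" and S: "finite S"
    and F [measurable]: "F \<in> borel_measurable (period_measure b)"
    and F2: "integrable (period_measure b) (\<lambda>t. (cmod (F t))\<^sup>2)"
  defines "I \<equiv> \<lambda>m. \<integral>t. F t * cnj (harmonic b m t) \<partial>period_measure b"
  shows "(\<integral>t. (cmod (F t - (\<Sum>m\<in>S. d m * harmonic b m t)))\<^sup>2 \<partial>period_measure b)
       = (\<integral>t. (cmod (F t))\<^sup>2 \<partial>period_measure b) - b * (\<Sum>m\<in>S. (cmod (I m))\<^sup>2)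
         + (\<Sum>m\<in>S. (cmod (d m - of_real b * I m))\<^sup>2) / b"
proof -
  let ?M = "period_measure b"
  let ?e = "harmonic b"
  define p where "p t = (\<Sum>m\<in>S. d m * ?e m t)" for t
  have intF: "integrable ?M (\<lambda>t. F t * cnj (?e m t))" for m
    using L2_harmonic[of b 1 b "-m"] by (intro L2_mult_integrable F2) (simp_all add: harmonic_cnj)
  have inte: "integrable ?M (\<lambda>t. ?e m t * cnj (?e k t))" for m k
    using L2_harmonic[of b 1 b "-k"] L2_harmonic[of b 1 b m]
    by (intro L2_mult_integrable) (simp_all add: harmonic_cnj)
  have ortho: "(\<integral>t. ?e m t * cnj (?e k t) \<partial>?M) = (if m = k then 1 / of_real b else 0)" for m k
    using harmonic_orthogonal[OF b, of "m - k"] harmonic_add[of b m "-k"]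
    by (simp add: harmonic_cnj)
  have cnjF: "integrable ?M (\<lambda>t. cnj (F t) * ?e m t)" for m
    using integrable_cnj[OF intF[of m]] by simp
  have Icnj: "(\<integral>t. cnj (F t) * ?e m t \<partial>?M) = cnj (I m)" for m
    using Bochner_Integration.integral_cnj[of ?M "\<lambda>t. F t * cnj (?e m t)"] by (simp add: I_def)
  have exp: "complex_of_real ((cmod (F t - p t))\<^sup>2) = of_real ((cmod (F t))\<^sup>2)
      - (\<Sum>m\<in>S. cnj (d m) * (F t * cnj (?e m t))) - (\<Sum>m\<in>S. d m * (cnj (F t) * ?e m t))
      + (\<Sum>m\<in>S. \<Sum>k\<in>S. d m * cnj (d k) * (?e m t * cnj (?e k t)))" for t
  proof -
    have "complex_of_real ((cmod (F t - p t))\<^sup>2) = (F t - p t) * cnj (F t - p t)"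
      by (simp only: complex_norm_square)
    also have "\<dots> = F t * cnj (F t) - F t * cnj (p t) - cnj (F t) * p t + p t * cnj (p t)"
      by (simp add: algebra_simps)
    also have "F t * cnj (p t) = (\<Sum>m\<in>S. cnj (d m) * (F t * cnj (?e m t)))"
      by (simp add: p_def sum_distrib_left mult_ac)
    also have "cnj (F t) * p t = (\<Sum>m\<in>S. d m * (cnj (F t) * ?e m t))"
      by (simp add: p_def sum_distrib_left mult_ac)
    also have "p t * cnj (p t) = (\<Sum>m\<in>S. \<Sum>k\<in>S. d m * cnj (d k) * (?e m t * cnj (?e k t)))"
      by (simp add: p_def sum_product mult_ac)
    finally show ?thesis
      by (simp only: complex_norm_square)
  qed
  have "complex_of_real (\<integral>t. (cmod (F t - p t))\<^sup>2 \<partial>?M)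
      = (\<integral>t. complex_of_real ((cmod (F t - p t))\<^sup>2) \<partial>?M)"
    by (rule integral_complex_of_real[symmetric])
  also have "\<dots> = of_real (\<integral>t. (cmod (F t))\<^sup>2 \<partial>?M) - (\<Sum>m\<in>S. cnj (d m) * I m)
      - (\<Sum>m\<in>S. d m * cnj (I m)) + (\<Sum>m\<in>S. \<Sum>k\<in>S. d m * cnj (d k) * (if m = k then 1 / of_real b else 0))"
  proof -
    have 1: "has_bochner_integral ?M (\<lambda>t. complex_of_real ((cmod (F t))\<^sup>2))
        (of_real (\<integral>t. (cmod (F t))\<^sup>2 \<partial>?M))"
      by (intro has_bochner_integral_of_real has_bochner_integral_integrable F2)
    have 2: "has_bochner_integral ?M (\<lambda>t. F t * cnj (?e m t)) (I m)" for m
      unfolding I_def by (rule has_bochner_integral_integrable[OF intF])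
    have 3: "has_bochner_integral ?M (\<lambda>t. cnj (F t) * ?e m t) (cnj (I m))" for m
      using has_bochner_integral_integrable[OF cnjF] by (simp only: Icnj)
    have 4: "has_bochner_integral ?M (\<lambda>t. ?e m t * cnj (?e k t)) (if m = k then 1 / of_real b else 0)" for m k
      using has_bochner_integral_integrable[OF inte] by (simp only: ortho)
    show ?thesis
      unfolding exp
      by (intro has_bochner_integral_integral_eq has_bochner_integral_add has_bochner_integral_diff
          has_bochner_integral_sum has_bochner_integral_mult_right 1 2 3 4)
  qed
  also have "(\<Sum>m\<in>S. \<Sum>k\<in>S. d m * cnj (d k) * (if m = k then 1 / of_real b else 0))
      = (\<Sum>m\<in>S. d m * cnj (d m) / of_real b)"
    using S by (intro sum.cong refl) (simp add: if_distrib sum.delta cong: if_cong)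
  also have "of_real (\<integral>t. (cmod (F t))\<^sup>2 \<partial>?M) - (\<Sum>m\<in>S. cnj (d m) * I m)
      - (\<Sum>m\<in>S. d m * cnj (I m)) + (\<Sum>m\<in>S. d m * cnj (d m) / of_real b)
      = of_real (\<integral>t. (cmod (F t))\<^sup>2 \<partial>?M) - of_real b * (\<Sum>m\<in>S. I m * cnj (I m))
        + (\<Sum>m\<in>S. (d m - of_real b * I m) * cnj (d m - of_real b * I m)) / of_real b"
  proof -
    have summand: "(d m - of_real b * I m) * cnj (d m - of_real b * I m) / of_real b
        = d m * cnj (d m) / of_real b - d m * cnj (I m) - cnj (d m) * I m
          + of_real b * (I m * cnj (I m))" for m
      using b by (simp add: field_simps)
    have total: "(\<Sum>m\<in>S. (d m - of_real b * I m) * cnj (d m - of_real b * I m)) / of_real b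
        = (\<Sum>m\<in>S. d m * cnj (d m) / of_real b) - (\<Sum>m\<in>S. d m * cnj (I m))
          - (\<Sum>m\<in>S. cnj (d m) * I m) + of_real b * (\<Sum>m\<in>S. I m * cnj (I m))"
      by (simp only: sum_divide_distrib summand sum.distrib sum_subtractf sum_distrib_left)
    have rearrange: "E - y - x + w = E - z + (w - x - y + z)" for E w x y z :: complex
      by simp
    show ?thesis
      unfolding total by (rule rearrange)
  qed
  also have "\<dots> = complex_of_real ((\<integral>t. (cmod (F t))\<^sup>2 \<partial>?M) - b * (\<Sum>m\<in>S. (cmod (I m))\<^sup>2)
         + (\<Sum>m\<in>S. (cmod (d m - of_real b * I m))\<^sup>2) / b)"
    by (simp only: complex_norm_square[symmetric] of_real_add of_real_diff of_real_mult
        of_real_divide of_real_sum)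
  finally show ?thesis
    unfolding p_def of_real_eq_iff .
qed

text \<open>The Fourier coefficients as choice of \<open>d\<close> in the previous identity give Bessel's inequality. The
  coefficients of an approximating trigonometric polynomial give the reverse inequality up to
  \<open>\<epsilon>\<close>, since its squared distance to \<open>F\<close> bounds the Bessel defect from above.\<close>

lemma parseval_period:
  assumes b: "b > 0"
    and F: "F \<in> borel_measurable (period_measure b)"
    and F2: "integrable (period_measure b) (\<lambda>t. (cmod (F t))\<^sup>2)"
  shows "((\<lambda>m. (cmod (\<integral>t. F t * cnj (harmonic b m t) \<partial>period_measure b))\<^sup>2)
           has_sum (1 / b * (\<integral>t. (cmod (F t))\<^sup>2 \<partial>period_measure b))) UNIV"
proof -
  define I where "I m = (\<integral>t. F t * cnj (harmonic b m t) \<partial>period_measure b)" for m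
  define E where "E = (\<integral>t. (cmod (F t))\<^sup>2 \<partial>period_measure b)"
  note dist = integral_square_distance_trig_polynomial[OF b _ F F2, folded I_def E_def]
  have upper: "(\<Sum>m\<in>S. (cmod (I m))\<^sup>2) \<le> 1 / b * E" if "finite S" for S
  proof -
    have "0 \<le> (\<integral>t. (cmod (F t - (\<Sum>m\<in>S. of_real b * I m * harmonic b m t)))\<^sup>2 \<partial>period_measure b)"
      by simp
    also have "\<dots> = E - b * (\<Sum>m\<in>S. (cmod (I m))\<^sup>2)"
      using dist[OF that, of "\<lambda>m. of_real b * I m"] by simp
    finally show ?thesis
      using b by (simp add: field_simps)
  qed
  have lower: "\<exists>S. finite S \<and> 1 / b * E - e < (\<Sum>m\<in>S. (cmod (I m))\<^sup>2)"
    if e: "e > 0" for e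
  proof -
    obtain p where p: "trig_polynomial b p"
      "(\<integral>t. (cmod (F t - p t))\<^sup>2 \<partial>period_measure b) < e * b"
      using trig_approximable_L2[OF b F F2] mult_pos_pos[OF e b] unfolding trig_approximable_def
      by blast
    then obtain S d where S: "finite S" "p = (\<lambda>t. \<Sum>m\<in>S. d m * harmonic b m t)"
      unfolding trig_polynomial_def by blast
    have "E - b * (\<Sum>m\<in>S. (cmod (I m))\<^sup>2)
        \<le> E - b * (\<Sum>m\<in>S. (cmod (I m))\<^sup>2) + (\<Sum>m\<in>S. (cmod (d m - of_real b * I m))\<^sup>2) / b"
      using b by (simp add: sum_nonneg)
    also have "\<dots> = (\<integral>t. (cmod (F t - p t))\<^sup>2 \<partial>period_measure b)"
      unfolding S(2) by (rule dist[OF S(1), symmetric])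
    also have "\<dots> < e * b"
      by (rule p(2))
    finally show ?thesis
      using b S(1) by (intro exI[of _ S]) (simp add: field_simps)
  qed
  have "((\<lambda>m. (cmod (I m))\<^sup>2) has_sum (1 / b * E)) UNIV"
    unfolding has_sum_def
  proof (rule order_tendstoI)
    fix y assume "y < 1 / b * E"
    then obtain S where S: "finite S" "y < (\<Sum>m\<in>S. (cmod (I m))\<^sup>2)"
      using lower[of "1 / b * E - y"] by auto
    have "y < (\<Sum>m\<in>T. (cmod (I m))\<^sup>2)" if "finite T" "S \<subseteq> T" for T
      using S(2) sum_mono2[OF that, of "\<lambda>m. (cmod (I m))\<^sup>2"] by simp
    then show "\<forall>\<^sub>F S in finite_subsets_at_top UNIV. y < (\<Sum>m\<in>S. (cmod (I m))\<^sup>2)"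
      unfolding eventually_finite_subsets_at_top using S(1) by auto
  next
    fix y assume "1 / b * E < y"
    then show "\<forall>\<^sub>F S in finite_subsets_at_top UNIV. (\<Sum>m\<in>S. (cmod (I m))\<^sup>2) < y"
      using upper by (intro eventually_finite_subsets_at_top_weakI) (auto intro: le_less_trans)
  qed
  then show ?thesis
    by (simp only: I_def E_def)
qed

section \<open>Translation and unfolding into periods\<close>

lemma borel_measurable_cnj [measurable (raw)]:
  "f \<in> borel_measurable M \<Longrightarrow> (\<lambda>x. cnj (f x)) \<in> borel_measurable M"
  by (rule measurable_compose[OF _ borel_measurable_continuous_onI[OF continuous_on_cnj[OF continuous_on_id]]])

lemma lebesgue_measurable_translate:
  assumes "f \<in> measurable lebesgue N"
  shows "(\<lambda>t::real. f (t - c)) \<in> measurable lebesgue N"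
proof -
  have "(\<lambda>t. - c + t) \<in> lebesgue \<rightarrow>\<^sub>M (lebesgue :: real measure)"
    using lebesgue_affine_measurable[of "\<lambda>_. 1::real" "- c"] by simp
  from measurable_compose[OF this assms] show ?thesis
    by simp
qed

lemma lebesgue_integrable_translate:
  fixes f :: "real \<Rightarrow> 'a :: euclidean_space"
  shows "integrable lebesgue f \<Longrightarrow> integrable lebesgue (\<lambda>t. f (t - c))"
  using lebesgue_integrable_real_affine[of f 1 "- c"] by simp

lemma lebesgue_integral_translate:
  fixes f :: "real \<Rightarrow> 'a :: euclidean_space"
  shows "(\<integral>t. f (t - c) \<partial>lebesgue) = (\<integral>t. f t \<partial>lebesgue)"
  using lebesgue_integral_real_affine[of 1 f "- c"] by simp

lemma nn_integral_translate:
  assumes "f \<in> borel_measurable lebesgue"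
  shows "(\<integral>\<^sup>+t. f (t - c) \<partial>lebesgue) = (\<integral>\<^sup>+t. f (t::real) \<partial>lebesgue)"
  using nn_integral_real_affine_lebesgue[OF assms, of 1 "- c"] by simp

lemma integral_period_measure:
  fixes f :: "real \<Rightarrow> complex"
  shows "(\<integral>t. f t \<partial>period_measure b) = (\<integral>t. indicator {0..<1/b} t *\<^sub>R f t \<partial>lebesgue)"
  unfolding period_measure_def by (rule integral_restrict_space) simp

lemma integrable_period_measure:
  fixes f :: "real \<Rightarrow> 'a :: {banach, second_countable_topology}"
  assumes "integrable lebesgue f"
  shows "integrable (period_measure b) f"
  unfolding period_measure_def
  by (subst integrable_restrict_space) (auto intro!: integrable_mult_indicator assms)

lemma period_cell_iff_floor:
  fixes b t :: real
  assumes "b > 0"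
  shows "t + of_int j / b \<in> {0..<1/b} \<longleftrightarrow> j = - \<lfloor>t * b\<rfloor>"
proof -
  have "t + of_int j / b \<in> {0..<1/b} \<longleftrightarrow> of_int (- j) \<le> t * b \<and> t * b < of_int (- j) + 1"
  proof -
    have "(t + of_int j / b) * b = t * b + of_int j"
      using assms by (simp add: distrib_right)
    moreover have "0 \<le> t + of_int j / b \<longleftrightarrow> 0 \<le> (t + of_int j / b) * b"
      using assms by (simp add: zero_le_mult_iff)
    moreover have "t + of_int j / b < 1/b \<longleftrightarrow> (t + of_int j / b) * b < 1"
      using assms by (simp add: pos_less_divide_eq)
    ultimately show ?thesis
      by auto
  qed
  also have "\<dots> \<longleftrightarrow> \<lfloor>t * b\<rfloor> = - j"
    by (rule floor_eq_iff[symmetric])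
  finally show ?thesis
    by auto
qed

text \<open>The line is the disjoint union of the intervals \<open>[0, 1/b) - j/b\<close>, and each piece is translated back
  to the period. The bound on \<open>K\<close> makes sure that all the pieces meeting the support are counted; the
  extra \<open>1\<close> accounts for the length of the period.\<close>

lemma integral_unfold_periods:
  fixes \<phi> :: "real \<Rightarrow> complex"
  assumes b: "b > 0" and int: "integrable lebesgue \<phi>"
    and supp: "\<And>t. \<phi> t \<noteq> 0 \<Longrightarrow> \<bar>t\<bar> \<le> R" and K: "R * b + 1 \<le> of_int K"
  shows "(\<integral>t. \<phi> t \<partial>lebesgue) = (\<Sum>j\<in>{-K..K}. \<integral>t. \<phi> (t - of_int j / b) \<partial>period_measure b)"
proof -
  define q where "q j t = (indicator {0..<1/b} (t + of_int j / b) :: real) *\<^sub>R \<phi> t" for j and t :: real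
  have ind: "indicator {0..<1/b} (t + of_int j / b) = (indicator {t. t + of_int j / b \<in> {0..<1/b}} t :: real)"
    for j and t :: real
    by (simp add: indicator_def)
  have "{t. t + of_int j / b \<in> {0..<1/b}} = {- of_int j / b ..< 1/b - of_int j / b}" for j
    by auto
  then have int_q: "integrable lebesgue (q j)" for j
    unfolding q_def ind by (intro integrable_mult_indicator int) simp
  have "\<phi> t = (\<Sum>j\<in>{-K..K}. q j t)" for t
  proof (cases "\<phi> t = 0")
    case False
    then have "\<bar>t * b\<bar> \<le> R * b"
      using supp[of t] b by (simp add: abs_mult)
    then have "\<lfloor>t * b\<rfloor> \<in> {-K..K}"
      using K by (simp add: floor_le_iff le_floor_iff) linarith
    moreover have "q j t = (if j = - \<lfloor>t * b\<rfloor> then \<phi> t else 0)" for j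
      using period_cell_iff_floor[OF b, of t j] by (simp add: q_def indicator_def)
    ultimately show ?thesis
      by auto
  qed (simp add: q_def)
  then have "(\<integral>t. \<phi> t \<partial>lebesgue) = (\<integral>t. (\<Sum>j\<in>{-K..K}. q j t) \<partial>lebesgue)"
    by simp
  also have "\<dots> = (\<Sum>j\<in>{-K..K}. \<integral>t. q j t \<partial>lebesgue)"
    by (intro Bochner_Integration.integral_sum int_q)
  finally have "(\<integral>t. \<phi> t \<partial>lebesgue) = (\<Sum>j\<in>{-K..K}. \<integral>t. q j t \<partial>lebesgue)" .
  moreover have "(\<integral>t. q j t \<partial>lebesgue) = (\<integral>t. \<phi> (t - of_int j / b) \<partial>period_measure b)" for j
    using lebesgue_integral_translate[of "q j" "of_int j / b"]
    by (simp add: q_def integral_period_measure)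
  ultimately show ?thesis
    by simp
qed

text \<open>On the period \<open>H\<close> is the full periodization of \<open>h\<close>, since the omitted translates vanish there.
  One of the two factors of \<open>|H|\<^sup>2\<close> is expanded into its summands, and the integral is unfolded.
  The periodization does not change under a shift by \<open>j / b\<close>, so the other factor can be written
  relative to the shifted point and expanded afterwards, which gives the autocorrelations of \<open>h\<close> at
  the multiples of \<open>1 / b\<close>. All sums are kept finite: the window \<open>{-(2*K)..2*K}\<close> is
  wide enough to contain the index window of \<open>H\<close> after every shift by an index \<open>j\<close> with
  \<open>|j| \<le> K\<close>.\<close>

lemma integral_finite_autocorrelation:
  fixes h :: "real \<Rightarrow> complex"
  assumes b: "b > 0" and [measurable]: "h \<in> borel_measurable lebesgue"
    and h2: "integrable lebesgue (\<lambda>t. (cmod (h t))\<^sup>2)"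
    and supp: "\<And>t. h t \<noteq> 0 \<Longrightarrow> \<bar>t\<bar> \<le> R" and K: "R * b + 1 \<le> of_int K"
  defines "H \<equiv> \<lambda>t. \<Sum>j\<in>{-K..K}. h (t - of_int j / b)"
  shows "(\<integral>t. complex_of_real ((cmod (H t))\<^sup>2) \<partial>period_measure b)
       = (\<Sum>k\<in>{-(2*K)..2*K}. \<integral>t. cnj (h t) * h (t - of_int k / b) \<partial>lebesgue)"
proof -
  let ?J = "{-K..K}" and ?J2 = "{-(2*K)..2*K}"
  have shift_meas [measurable]: "(\<lambda>t. h (t - c)) \<in> borel_measurable lebesgue" for c
    by (rule lebesgue_measurable_translate) measurable
  have shift_L2: "integrable lebesgue (\<lambda>t. (cmod (h (t - c)))\<^sup>2)" for c
    by (rule lebesgue_integrable_translate[OF h2])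
  have int_prod: "integrable lebesgue (\<lambda>t. cnj (h (t - c)) * h (t - d))" for c d
    using shift_L2[of c] shift_L2[of d]
    by (intro L2_mult_integrable) (simp_all add: borel_measurable_cnj shift_meas)
  define \<Phi> where "\<Phi> s = (\<Sum>k\<in>?J2. cnj (h s) * h (s - of_int k / b))" for s
  have int_\<Phi>: "integrable lebesgue \<Phi>"
    unfolding \<Phi>_def using int_prod[of 0] by (intro Bochner_Integration.integrable_sum) simp
  have H_eq: "H t = (\<Sum>k\<in>?J2. h (t - of_int j / b - of_int k / b))"
    if t: "t \<in> {0..<1/b}" and j: "j \<in> ?J" for t j
  proof -
    \<comment> \<open>Outside \<open>{-K..K}\<close> the translates of \<open>h\<close> vanish on the period.\<close>
    have zero: "h (t - of_int l / b) = 0" if "l \<notin> ?J" for l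
    proof (rule ccontr)
      assume "h (t - of_int l / b) \<noteq> 0"
      then have "\<bar>t - of_int l / b\<bar> * b \<le> R * b"
        using supp b by (intro mult_right_mono) auto
      also have "\<bar>t - of_int l / b\<bar> * b = \<bar>(t - of_int l / b) * b\<bar>"
        using b by (simp add: abs_mult)
      also have "(t - of_int l / b) * b = t * b - of_int l"
        using b by (simp add: left_diff_distrib)
      finally have "\<bar>t * b - of_int l\<bar> \<le> R * b" .
      moreover have "0 \<le> t * b" "t * b < 1"
        using t b by (simp_all add: field_simps)
      ultimately have "\<bar>of_int l\<bar> \<le> (of_int K :: real)"
        using K by linarith
      then show False
        using that by auto
    qed
    have "(\<Sum>k\<in>?J2. h (t - of_int j / b - of_int k / b)) = (\<Sum>l\<in>{j-2*K..j+2*K}. h (t - of_int l / b))"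
      by (rule sum.reindex_bij_witness[of _ "\<lambda>l. l - j" "\<lambda>k. j + k"])
         (auto simp: add_divide_distrib algebra_simps)
    also have "\<dots> = H t"
      unfolding H_def by (rule sum.mono_neutral_right) (use j zero in auto)
    finally show ?thesis
      by simp
  qed
  have "(\<integral>t. complex_of_real ((cmod (H t))\<^sup>2) \<partial>period_measure b)
      = (\<integral>t. (\<Sum>j\<in>?J. \<Phi> (t - of_int j / b)) \<partial>period_measure b)"
  proof (rule Bochner_Integration.integral_cong[OF refl])
    fix t assume "t \<in> space (period_measure b)"
    then have t: "t \<in> {0..<1/b}"
      by simp
    have "complex_of_real ((cmod (H t))\<^sup>2) = cnj (H t) * H t"
      by (simp only: complex_norm_square mult.commute)
    also have "\<dots> = (\<Sum>j\<in>?J. cnj (h (t - of_int j / b)) * H t)"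
      by (subst (1) H_def) (simp add: sum_distrib_right)
    also have "\<dots> = (\<Sum>j\<in>?J. \<Phi> (t - of_int j / b))"
      unfolding \<Phi>_def by (intro sum.cong refl) (simp only: H_eq[OF t] sum_distrib_left)
    finally show "complex_of_real ((cmod (H t))\<^sup>2) = (\<Sum>j\<in>?J. \<Phi> (t - of_int j / b))" .
  qed
  also have "\<dots> = (\<Sum>j\<in>?J. \<integral>t. \<Phi> (t - of_int j / b) \<partial>period_measure b)"
    by (intro Bochner_Integration.integral_sum integrable_period_measure
        lebesgue_integrable_translate int_\<Phi>)
  also have "\<dots> = (\<integral>t. \<Phi> t \<partial>lebesgue)"
  proof (rule integral_unfold_periods[OF b int_\<Phi> _ K, symmetric])
    fix t assume "\<Phi> t \<noteq> 0"
    then have "h t \<noteq> 0"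
      by (auto simp: \<Phi>_def)
    then show "\<bar>t\<bar> \<le> R"
      by (rule supp)
  qed
  also have "\<dots> = (\<Sum>k\<in>?J2. \<integral>t. cnj (h t) * h (t - of_int k / b) \<partial>lebesgue)"
    unfolding \<Phi>_def using int_prod[of 0] by (intro Bochner_Integration.integral_sum) simp
  finally show ?thesis .
qed

section \<open>The identity for a single translate\<close>

lemma integrable_of_L2_bounded_support:
  fixes h :: "real \<Rightarrow> complex"
  assumes [measurable]: "h \<in> borel_measurable lebesgue"
    and h2: "integrable lebesgue (\<lambda>t. (cmod (h t))\<^sup>2)"
    and supp: "\<And>t. h t \<noteq> 0 \<Longrightarrow> \<bar>t\<bar> \<le> R"
  shows "integrable lebesgue h"
proof -
  have "integrable lebesgue (\<lambda>t. h t * indicator {-R..R} t)"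
  proof (rule L2_mult_integrable[OF _ _ h2])
    have "(\<lambda>t. (cmod (indicator {-R..R} t))\<^sup>2) = (indicator {-R..R} :: real \<Rightarrow> real)"
      by (auto simp: indicator_def)
    then show "integrable lebesgue (\<lambda>t. (cmod (indicator {-R..R} t))\<^sup>2)"
      using emeasure_bounded_finite[of "{-R..R}"] by (simp add: integrable_indicator_iff)
    show "indicator {-R..R} \<in> borel_measurable lebesgue"
      by (rule borel_measurable_indicator) simp
  qed (rule assms(1))
  also have "(\<lambda>t. h t * indicator {-R..R} t) = h"
  proof
    fix t show "h t * indicator {-R..R} t = h t"
      using supp[of t] by (cases "h t = 0") (auto simp: indicator_def)
  qed
  finally show ?thesis .
qed

text \<open>The Fourier integrals of \<open>h\<close> at the frequencies \<open>m b\<close> are the Fourier coefficients of its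
  periodization, because the harmonics are periodic. Parseval's identity for the periodization is
  therefore a form of Poisson summation for the autocorrelation of \<open>h\<close>. For \<open>h t = f t * cnj (g (t - n a))\<close>
  it is the part of the frame identity that belongs to a fixed \<open>n\<close>.\<close>

lemma parseval_bounded_support:
  fixes h :: "real \<Rightarrow> complex"
  assumes b: "b > 0" and meas [measurable]: "h \<in> borel_measurable lebesgue"
    and h2: "integrable lebesgue (\<lambda>t. (cmod (h t))\<^sup>2)"
    and supp: "\<And>t. h t \<noteq> 0 \<Longrightarrow> \<bar>t\<bar> \<le> R" and K: "R * b + 1 \<le> of_int K"
  shows "((\<lambda>m. complex_of_real ((cmod (\<integral>t. h t * cnj (harmonic b m t) \<partial>lebesgue))\<^sup>2)) has_sum
     (1 / of_real b * (\<Sum>k\<in>{-(2*K)..2*K}. \<integral>t. cnj (h t) * h (t - of_int k / b) \<partial>lebesgue))) UNIV"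
proof -
  let ?J = "{-K..K}"
  define H where "H t = (\<Sum>j\<in>?J. h (t - of_int j / b))" for t
  have int_h: "integrable lebesgue h"
    by (rule integrable_of_L2_bounded_support[OF meas h2 supp])
  have shift_meas [measurable]: "(\<lambda>t. h (t - c)) \<in> borel_measurable lebesgue" for c
    by (rule lebesgue_measurable_translate) measurable
  have H_meas: "H \<in> borel_measurable lebesgue"
    unfolding H_def by measurable
  have H_L2: "integrable lebesgue (\<lambda>t. (cmod (H t))\<^sup>2)"
    unfolding H_def by (intro L2_sum_integrable lebesgue_integrable_translate[OF h2]) simp_all
  have coeff: "(\<integral>t. h t * cnj (harmonic b m t) \<partial>lebesgue) = (\<integral>t. H t * cnj (harmonic b m t) \<partial>period_measure b)" for m
  proof -
    have int_he: "integrable lebesgue (\<lambda>t. h t * cnj (harmonic b m t))"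
      by (rule Bochner_Integration.integrable_bound[OF int_h]) (simp_all add: norm_mult harmonic_cnj)
    have "(\<integral>t. h t * cnj (harmonic b m t) \<partial>lebesgue)
        = (\<Sum>j\<in>?J. \<integral>t. h (t - of_int j / b) * cnj (harmonic b m (t - of_int j / b)) \<partial>period_measure b)"
      by (rule integral_unfold_periods[OF b int_he _ K]) (auto intro: supp)
    also have "\<dots> = (\<integral>t. (\<Sum>j\<in>?J. h (t - of_int j / b) * cnj (harmonic b m (t - of_int j / b))) \<partial>period_measure b)"
      by (intro Bochner_Integration.integral_sum[symmetric] integrable_period_measure
          lebesgue_integrable_translate[OF int_he])
    also have "\<dots> = (\<integral>t. H t * cnj (harmonic b m t) \<partial>period_measure b)"
      by (simp only: harmonic_shift[OF b] H_def sum_distrib_right)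
    finally show ?thesis .
  qed
  have "((\<lambda>m. complex_of_real ((cmod (\<integral>t. H t * cnj (harmonic b m t) \<partial>period_measure b))\<^sup>2))
     has_sum complex_of_real (1 / b * (\<integral>t. (cmod (H t))\<^sup>2 \<partial>period_measure b))) UNIV"
    by (intro has_sum_of_real parseval_period b measurable_period_measure H_meas
        integrable_period_measure H_L2)
  also have "complex_of_real (1 / b * (\<integral>t. (cmod (H t))\<^sup>2 \<partial>period_measure b))
      = 1 / of_real b * (\<integral>t. complex_of_real ((cmod (H t))\<^sup>2) \<partial>period_measure b)"
    by (simp only: integral_complex_of_real of_real_mult of_real_divide of_real_1)
  also have "(\<integral>t. complex_of_real ((cmod (H t))\<^sup>2) \<partial>period_measure b)
      = (\<Sum>k\<in>{-(2*K)..2*K}. \<integral>t. cnj (h t) * h (t - of_int k / b) \<partial>lebesgue)"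
    unfolding H_def by (rule integral_finite_autocorrelation[OF b meas h2 supp K])
  finally show ?thesis
    by (simp only: coeff)
qed

section \<open>Summation over the translates\<close>

lemma card_int_interval_le:
  fixes x y :: real
  assumes "x \<le> y" "S \<subseteq> {n::int. x \<le> of_int n \<and> of_int n \<le> y}"
  shows "real (card S) \<le> y - x + 1"
proof -
  have "S \<subseteq> {\<lceil>x\<rceil>..\<lfloor>y\<rfloor>}"
    using assms(2) by (auto simp: ceiling_le_iff le_floor_iff)
  then have "card S \<le> card {\<lceil>x\<rceil>..\<lfloor>y\<rfloor>}"
    by (intro card_mono) auto
  also have "\<dots> = nat (\<lfloor>y\<rfloor> - \<lceil>x\<rceil> + 1)"
    by simp
  finally have "real (card S) \<le> real (nat (\<lfloor>y\<rfloor> - \<lceil>x\<rceil> + 1))"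
    by simp
  also have "\<dots> \<le> y - x + 1"
    using assms(1) of_int_floor_le[of y] le_of_int_ceiling[of x]
    by (cases "0 \<le> \<lfloor>y\<rfloor> - \<lceil>x\<rceil> + 1") (simp_all del: of_int_floor_le le_of_int_ceiling)
  finally show ?thesis .
qed

text \<open>Each point lies in at most \<open>(d - c) / a + 1\<close> of the windows \<open>[c, d] - n a\<close>. This overlap count is
  what makes the sum over all translates of an integrable function converge on a bounded interval.\<close>

lemma sum_integral_translates_le:
  fixes \<phi> :: "real \<Rightarrow> real"
  assumes a: "a > 0" and cd: "c \<le> d" and int: "integrable lebesgue \<phi>" and nonneg: "\<And>t. 0 \<le> \<phi> t"
    and S: "finite S"
  shows "(\<Sum>n\<in>S. \<integral>t. indicator {c..d} t * \<phi> (t - of_int n * a) \<partial>lebesgue)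
       \<le> ((d - c) / a + 1) * (\<integral>t. \<phi> t \<partial>lebesgue)"
proof -
  define w where "w n s = indicator {c..d} (s + of_int n * a) * \<phi> s" for n :: int and s
  have "indicator {c..d} (s + of_int n * a) = (indicator {c - of_int n * a..d - of_int n * a} s :: real)"
    for n :: int and s :: real
    by (auto simp: indicator_def)
  then have int_w: "integrable lebesgue (w n)" for n
    unfolding w_def using integrable_mult_indicator[OF _ int, of "{c - of_int n * a..d - of_int n * a}"]
    by simp
  have "(\<integral>t. indicator {c..d} t * \<phi> (t - of_int n * a) \<partial>lebesgue) = (\<integral>s. w n s \<partial>lebesgue)" for n
    using lebesgue_integral_translate[of "w n" "of_int n * a"] by (simp add: w_def)
  then have "(\<Sum>n\<in>S. \<integral>t. indicator {c..d} t * \<phi> (t - of_int n * a) \<partial>lebesgue)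
      = (\<integral>s. (\<Sum>n\<in>S. w n s) \<partial>lebesgue)"
    using int_w by (simp add: Bochner_Integration.integral_sum)
  also have "\<dots> \<le> (\<integral>s. ((d - c) / a + 1) * \<phi> s \<partial>lebesgue)"
  proof (rule integral_mono)
    fix s
    define T where "T = {n\<in>S. c \<le> s + of_int n * a \<and> s + of_int n * a \<le> d}"
    have "(\<Sum>n\<in>S. w n s) = (\<Sum>n\<in>S. indicator {c..d} (s + of_int n * a)) * \<phi> s"
      by (simp add: w_def sum_distrib_right)
    also have "(\<Sum>n\<in>S. indicator {c..d} (s + of_int n * a)) = real (card T)"
    proof -
      have "(\<Sum>n\<in>S. indicator {c..d} (s + of_int n * a)) = (\<Sum>n\<in>T. 1::real)"
        unfolding T_def by (rule sum.mono_neutral_cong_right) (use S in \<open>auto simp: indicator_def\<close>)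
      then show ?thesis
        by simp
    qed
    also have "real (card T) \<le> (d - s) / a - (c - s) / a + 1"
      using a cd by (intro card_int_interval_le divide_right_mono) (auto simp: T_def field_simps)
    also have "(d - s) / a - (c - s) / a + 1 = (d - c) / a + 1"
      by (simp add: diff_divide_distrib)
    finally show "(\<Sum>n\<in>S. w n s) \<le> ((d - c) / a + 1) * \<phi> s"
      using nonneg[of s] by (simp add: mult_right_mono)
  qed (use int int_w in auto)
  also have "\<dots> = ((d - c) / a + 1) * (\<integral>t. \<phi> t \<partial>lebesgue)"
    by simp
  finally show ?thesis .
qed

text \<open>Fubini's theorem for an unconditional series over the integers. An enumeration of the integers
  reduces it to the theorem for sequences; absolute convergence makes the order irrelevant. The
  infinite sum is measurable because it agrees almost everywhere with a sequential series and
  Lebesgue measure is complete.\<close>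

lemma integral_has_sum_int:
  fixes f :: "int \<Rightarrow> real \<Rightarrow> complex"
  assumes int: "\<And>n. integrable lebesgue (f n)"
    and bound: "\<And>S. finite S \<Longrightarrow> (\<Sum>n\<in>S. \<integral>x. norm (f n x) \<partial>lebesgue) \<le> C"
  shows "AE x in lebesgue. (\<lambda>n. norm (f n x)) summable_on UNIV"
    and "integrable lebesgue (\<lambda>x. \<Sum>\<^sub>\<infinity>n. f n x)"
    and "((\<lambda>n. \<integral>x. f n x \<partial>lebesgue) has_sum (\<integral>x. (\<Sum>\<^sub>\<infinity>n. f n x) \<partial>lebesgue)) UNIV"
proof -
  define u where "u i = f (int_decode i)" for i
  have int_u [measurable]: "integrable lebesgue (u i)" for i
    unfolding u_def by (rule int)
  have reindex: "((\<lambda>i. v (int_decode i)) has_sum s) UNIV \<longleftrightarrow> (v has_sum s) UNIV"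
    for v :: "int \<Rightarrow> 'c::{comm_monoid_add, topological_space}" and s
    by (rule has_sum_reindex_bij_betw) (rule bij_int_decode)
  have bound_u: "(\<Sum>i\<in>S. \<integral>x. norm (u i x) \<partial>lebesgue) \<le> C" if "finite S" for S
    using bound[of "int_decode ` S"] that sum.reindex[OF inj_on_subset[OF inj_int_decode subset_UNIV], of "\<lambda>n. \<integral>x. norm (f n x) \<partial>lebesgue" S]
    by (simp add: u_def o_def)
  have sum_int: "summable (\<lambda>i. \<integral>x. norm (u i x) \<partial>lebesgue)"
    by (rule summableI_nonneg_bounded[of _ C]) (auto intro: bound_u)
  have "(\<integral>\<^sup>+x. (\<Sum>i. ennreal (norm (u i x))) \<partial>lebesgue) = (\<Sum>i. \<integral>\<^sup>+x. ennreal (norm (u i x)) \<partial>lebesgue)"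
    by (rule nn_integral_suminf) measurable
  also have "\<dots> = (\<Sum>i. ennreal (\<integral>x. norm (u i x) \<partial>lebesgue))"
    by (intro suminf_cong nn_integral_eq_integral) (auto intro: int_u)
  also have "\<dots> \<noteq> \<infinity>"
    using sum_int by (simp add: ennreal_suminf_neq_top)
  finally have "AE x in lebesgue. (\<Sum>i. ennreal (norm (u i x))) \<noteq> \<infinity>"
    by (intro nn_integral_PInf_AE) measurable
  then have ae: "AE x in lebesgue. summable (\<lambda>i. norm (u i x))"
    by eventually_elim (auto intro: summable_suminf_not_top)
  have norm_sum: "(\<lambda>n. norm (f n x)) summable_on UNIV" if "summable (\<lambda>i. norm (u i x))" for x
  proof -
    have "((\<lambda>i. norm (u i x)) has_sum (\<Sum>i. norm (u i x))) UNIV"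
      using that by (intro norm_summable_imp_has_sum) (auto intro: summable_sums)
    then have "((\<lambda>n. norm (f n x)) has_sum (\<Sum>i. norm (u i x))) UNIV"
      unfolding u_def by (rule reindex[THEN iffD1])
    then show ?thesis
      by (rule has_sum_imp_summable)
  qed
  have infsum_eq: "(\<Sum>i. u i x) = (\<Sum>\<^sub>\<infinity>n. f n x)" if "summable (\<lambda>i. norm (u i x))" for x
  proof -
    have "((\<lambda>i. u i x) has_sum (\<Sum>i. u i x)) UNIV"
      by (rule norm_summable_imp_has_sum[OF that summable_sums[OF summable_norm_cancel[OF that]]])
    then have "((\<lambda>n. f n x) has_sum (\<Sum>i. u i x)) UNIV"
      unfolding u_def by (rule reindex[THEN iffD1])
    then show ?thesis
      by (rule infsumI[symmetric])
  qed
  have ae_eq: "AE x in lebesgue. (\<Sum>i. u i x) = (\<Sum>\<^sub>\<infinity>n. f n x)"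
    using ae by eventually_elim (rule infsum_eq)
  have int_suminf: "integrable lebesgue (\<lambda>x. \<Sum>i. u i x)"
    by (rule integrable_suminf[OF int_u ae sum_int])
  have meas: "(\<lambda>x. \<Sum>\<^sub>\<infinity>n. f n x) \<in> borel_measurable lebesgue"
    by (rule borel_measurable_AE[OF borel_measurable_integrable[OF int_suminf] ae_eq])
  show "AE x in lebesgue. (\<lambda>n. norm (f n x)) summable_on UNIV"
    using ae by eventually_elim (rule norm_sum)
  show "integrable lebesgue (\<lambda>x. \<Sum>\<^sub>\<infinity>n. f n x)"
    by (rule integrable_cong_AE_imp[OF int_suminf meas]) (use ae_eq in eventually_elim, simp)
  have "(\<integral>x. (\<Sum>i. u i x) \<partial>lebesgue) = (\<integral>x. (\<Sum>\<^sub>\<infinity>n. f n x) \<partial>lebesgue)"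
    by (rule integral_cong_AE[OF borel_measurable_integrable[OF int_suminf] meas ae_eq])
  moreover have "((\<lambda>i. \<integral>x. u i x \<partial>lebesgue) has_sum (\<integral>x. (\<Sum>i. u i x) \<partial>lebesgue)) UNIV"
  proof (rule norm_summable_imp_has_sum)
    show "summable (\<lambda>i. norm (\<integral>x. u i x \<partial>lebesgue))"
      by (rule summable_comparison_test'[OF sum_int, of 0]) simp
    show "(\<lambda>i. \<integral>x. u i x \<partial>lebesgue) sums (\<integral>x. (\<Sum>i. u i x) \<partial>lebesgue)"
      by (rule sums_integral[OF int_u ae sum_int])
  qed
  ultimately show "((\<lambda>n. \<integral>x. f n x \<partial>lebesgue) has_sum (\<integral>x. (\<Sum>\<^sub>\<infinity>n. f n x) \<partial>lebesgue)) UNIV"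
    unfolding u_def by (simp only: reindex[of "\<lambda>n. \<integral>x. f n x \<partial>lebesgue"])
qed

lemma has_sum_finite_sum:
  fixes f :: "'i \<Rightarrow> 'a \<Rightarrow> complex"
  assumes "finite S" "\<And>i. i \<in> S \<Longrightarrow> (f i has_sum s i) A"
  shows "((\<lambda>x. \<Sum>i\<in>S. f i x) has_sum (\<Sum>i\<in>S. s i)) A"
  using assms by (induction S) (auto intro: has_sum_add)

section \<open>The frame identity for square-integrable windows\<close>

lemma WH_atom_eq: "WH_atom g a b m n x = harmonic b m x * g (x - of_int n * a)"
  by (simp add: WH_atom_def modulation_def translation_def harmonic_def)

lemma bounded_compactly_supported_bounds:
  assumes "bounded_compactly_supported f"
  obtains B R where "B \<ge> 0" "\<And>x. cmod (f x) \<le> B" "R \<ge> 0" "\<And>x. f x \<noteq> 0 \<Longrightarrow> \<bar>x\<bar> \<le> R"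
proof -
  have "bounded (range f)" and "bounded (closure (support_on UNIV f))"
    using assms compact_imp_bounded by (auto simp: bounded_compactly_supported_def)
  then obtain B R where B: "B > 0" "\<And>x. cmod (f x) \<le> B"
    and R: "R > 0" "\<And>x. x \<in> closure (support_on UNIV f) \<Longrightarrow> norm x \<le> R"
    unfolding bounded_pos by blast
  have "\<bar>x\<bar> \<le> R" if "f x \<noteq> 0" for x
    using R(2)[of x] that closure_subset[of "support_on UNIV f"] by (auto simp: support_on_def)
  then show ?thesis
    using B R(1) by (intro that[of B R]) auto
qed

text \<open>For fixed \<open>n\<close> the sum over \<open>m\<close> is a finite sum over \<open>k\<close>, with the same range of \<open>k\<close> for all \<open>n\<close>
  because the supports of the functions \<open>h n\<close> all lie in that of \<open>f\<close>. For fixed \<open>k\<close> the sum over \<open>n\<close>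
  can be moved under the integral, where it produces \<open>G g a b k\<close>. Since the terms on the left are
  nonnegative, summing the rows and then the row sums is the same as summing over all pairs.\<close>

lemma WH_frame_identity_of_L2:
  assumes a: "a > 0" and b: "b > 0" and g: "g \<in> L2_functions"
    and f: "bounded_compactly_supported f"
  shows "WH_frame_identity_holds g a b f"
proof -
  obtain B R where B: "B \<ge> 0" "\<And>x. cmod (f x) \<le> B" and R: "R \<ge> 0" "\<And>x. f x \<noteq> 0 \<Longrightarrow> \<bar>x\<bar> \<le> R"
    using bounded_compactly_supported_bounds[OF f] by metis
  have [measurable]: "f \<in> borel_measurable lebesgue"
    using f by (simp add: bounded_compactly_supported_def)
  have g_meas: "g \<in> borel_measurable lebesgue"
    and g2: "integrable lebesgue (\<lambda>x. (cmod (g x))\<^sup>2)"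
    using g by (simp_all add: L2_functions_def)
  have [measurable]: "(\<lambda>t. g (t - c)) \<in> borel_measurable lebesgue" for c
    by (rule lebesgue_measurable_translate[OF g_meas])
  have g2_shift: "integrable lebesgue (\<lambda>t. (cmod (g (t - c)))\<^sup>2)" for c
    by (rule lebesgue_integrable_translate[OF g2])

  define h where "h n t = f t * cnj (g (t - of_int n * a))" for n :: int and t
  have h_meas [measurable]: "h n \<in> borel_measurable lebesgue" for n
    unfolding h_def by measurable
  have h2: "integrable lebesgue (\<lambda>t. (cmod (h n t))\<^sup>2)" for n
  proof (rule Bochner_Integration.integrable_bound)
    show "integrable lebesgue (\<lambda>t. B\<^sup>2 * (cmod (g (t - of_int n * a)))\<^sup>2)"
      using g2_shift by simp
    have "(cmod (h n t))\<^sup>2 \<le> B\<^sup>2 * (cmod (g (t - of_int n * a)))\<^sup>2" for t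
      unfolding h_def norm_mult power_mult_distrib
      by (intro mult_mono power_mono) (use B in auto)
    then show "AE t in lebesgue. norm ((cmod (h n t))\<^sup>2) \<le> norm (B\<^sup>2 * (cmod (g (t - of_int n * a)))\<^sup>2)"
      by (intro AE_I2) simp
  qed measurable
  have h_supp: "\<bar>t\<bar> \<le> R" if "h n t \<noteq> 0" for n t
    using that by (intro R(2)) (auto simp: h_def)
  have int_h: "integrable lebesgue (h n)" for n
    by (rule integrable_of_L2_bounded_support[OF h_meas h2 h_supp])
  have atom_eq: "f x * cnj (WH_atom g a b m n x) = h n x * cnj (harmonic b m x)" for m n x
    by (simp add: WH_atom_eq h_def)
  have pairing_eq: "pairing f (WH_atom g a b m n) = (\<integral>x. h n x * cnj (harmonic b m x) \<partial>lebesgue)" for m n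
    by (simp only: pairing_def atom_eq)

  define T where "T k n t = f_product f b k t * G_term g a b k t n" for k n t
  have T_eq: "T k n t = cnj (h n t) * h n (t - of_int k / b)" for k n t
    by (simp add: T_def f_product_def G_term_def h_def algebra_simps)
  have h_shift_meas [measurable]: "(\<lambda>t. h n (t - c)) \<in> borel_measurable lebesgue" for n c
    by (rule lebesgue_measurable_translate[OF h_meas])
  have int_T: "integrable lebesgue (T k n)" for k n
    unfolding T_eq[abs_def] using h2 lebesgue_integrable_translate[OF h2]
    by (intro L2_mult_integrable) simp_all

  define N where "N = (\<integral>t. (cmod (g t))\<^sup>2 \<partial>lebesgue)"
  define C where "C = B\<^sup>2 * (2 * ((R - (- R)) / a + 1) * N)"
  have T_bound: "(\<Sum>n\<in>S. \<integral>t. norm (T k n t) \<partial>lebesgue) \<le> C" if S: "finite S" for S k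
  proof -
    \<comment> \<open>By \<open>u v \<le> u\<^sup>2 + v\<^sup>2\<close> the translate of \<open>\<phi>\<close> by \<open>n a\<close> dominates the \<open>n\<close>-th term of \<open>G\<close>.\<close>
    define \<phi> where "\<phi> t = (cmod (g t))\<^sup>2 + (cmod (g (t - of_int k / b)))\<^sup>2" for t
    have int_\<phi>: "integrable lebesgue \<phi>"
      unfolding \<phi>_def using g2 g2_shift by simp
    have "integral\<^sup>L lebesgue \<phi> = 2 * N"
      unfolding \<phi>_def using g2 g2_shift lebesgue_integral_translate[of "\<lambda>t. (cmod (g t))\<^sup>2" "of_int k / b"]
      by (simp add: N_def)
    have bnd: "norm (T k n t) \<le> B\<^sup>2 * (indicator {-R..R} t * \<phi> (t - of_int n * a))" for n t
    proof (cases "f t = 0")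
      case True
      then show ?thesis
        by (simp add: T_def f_product_def \<phi>_def)
    next
      case False
      then have t: "t \<in> {-R..R}"
        using R(2)[of t] by auto
      have "norm (f_product f b k t) \<le> B * B"
        unfolding f_product_def norm_mult by (intro mult_mono) (use B in auto)
      moreover have "norm (G_term g a b k t n) \<le> \<phi> (t - of_int n * a)"
      proof -
        have "u * v \<le> u\<^sup>2 + v\<^sup>2" if "u \<ge> 0" "v \<ge> 0" for u v :: real
          using that sum_squares_bound[of u v] mult_nonneg_nonneg[of u v] by linarith
        then show ?thesis
          by (simp add: G_term_def \<phi>_def norm_mult)
      qed
      ultimately have "norm (T k n t) \<le> (B * B) * \<phi> (t - of_int n * a)"
        unfolding T_def norm_mult by (intro mult_mono) (use B in auto)
      then show ?thesis
        using t by (simp add: power2_eq_square)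
    qed
    have int_ind: "integrable lebesgue (\<lambda>t. indicator {-R..R} t * \<phi> (t - of_int n * a))" for n
      using integrable_mult_indicator[OF _ lebesgue_integrable_translate[OF int_\<phi>], of "{-R..R}"]
      by simp
    have "(\<Sum>n\<in>S. \<integral>t. norm (T k n t) \<partial>lebesgue)
        \<le> (\<Sum>n\<in>S. \<integral>t. B\<^sup>2 * (indicator {-R..R} t * \<phi> (t - of_int n * a)) \<partial>lebesgue)"
    proof (intro sum_mono integral_mono bnd)
      show "integrable lebesgue (\<lambda>t. B\<^sup>2 * (indicator {-R..R} t * \<phi> (t - of_int n * a)))" for n
        by (rule integrable_mult_right) (rule int_ind)
    qed (simp add: int_T)
    also have "\<dots> = B\<^sup>2 * (\<Sum>n\<in>S. \<integral>t. indicator {-R..R} t * \<phi> (t - of_int n * a) \<partial>lebesgue)"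
      by (simp only: integral_mult_right_zero sum_distrib_left)
    also have "\<dots> \<le> B\<^sup>2 * (((R - (- R)) / a + 1) * integral\<^sup>L lebesgue \<phi>)"
      using R(1) by (intro mult_left_mono sum_integral_translates_le a int_\<phi> S) (auto simp: \<phi>_def)
    also have "\<dots> = C"
      by (simp add: C_def \<open>integral\<^sup>L lebesgue \<phi> = 2 * N\<close>)
    finally show ?thesis .
  qed
  have T_sum: "AE t in lebesgue. (\<lambda>n. norm (T k n t)) summable_on UNIV"
    "integrable lebesgue (\<lambda>t. \<Sum>\<^sub>\<infinity>n. T k n t)"
    "((\<lambda>n. \<integral>t. T k n t \<partial>lebesgue) has_sum (\<integral>t. (\<Sum>\<^sub>\<infinity>n. T k n t) \<partial>lebesgue)) UNIV" for k
    by (rule integral_has_sum_int[OF int_T T_bound], assumption)+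
  have infsum_T: "(\<Sum>\<^sub>\<infinity>n. T k n t) = f_product f b k t * G g a b k t" for k t
    unfolding T_def G_def by (rule infsum_cmult_right')
  define A where "A k = (\<integral>t. f_product f b k t * G g a b k t \<partial>lebesgue)" for k
  have A_sum: "((\<lambda>n. \<integral>t. T k n t \<partial>lebesgue) has_sum A k) UNIV" for k
    using T_sum(3)[of k] by (simp only: infsum_T A_def)

  define K where "K = \<lceil>R * b + 1\<rceil>"
  have K: "R * b + 1 \<le> of_int K"
    by (simp add: K_def)
  let ?J = "{-(2*K)..2*K}"
  \<comment> \<open>If \<open>|k| / b > 2 R\<close>, then \<open>f\<close> and its translate by \<open>k / b\<close> have disjoint supports.\<close>
  have A_zero: "A k = 0" if "k \<notin> ?J" for k
  proof -
    have "f_product f b k t = 0" for t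
    proof (rule ccontr)
      assume "f_product f b k t \<noteq> 0"
      then have "\<bar>t\<bar> \<le> R" "\<bar>t - of_int k / b\<bar> \<le> R"
        by (auto simp: f_product_def intro: R(2))
      then have "\<bar>of_int k / b\<bar> \<le> 2 * R"
        by linarith
      then have "\<bar>of_int k\<bar> \<le> 2 * (R * b)"
        using b by (simp add: abs_divide field_simps)
      then have "\<bar>of_int k\<bar> \<le> (of_int (2 * K) :: real)"
        using K by simp
      then show False
        using that by auto
    qed
    then show ?thesis
      by (simp add: A_def)
  qed
  have A_has_sum: "(A has_sum (\<Sum>k\<in>?J. A k)) UNIV"
    by (rule has_sum_finite_neutralI[of ?J]) (use A_zero in auto)

  define s where "s n = 1 / of_real b * (\<Sum>k\<in>?J. \<integral>t. T k n t \<partial>lebesgue)" for n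
  define X where "X n m = (cmod (pairing f (WH_atom g a b m n)))\<^sup>2" for n m
  have row: "((\<lambda>m. complex_of_real (X n m)) has_sum s n) UNIV" for n
    using parseval_bounded_support[OF b h_meas h2 h_supp K, of n]
    by (simp only: X_def s_def pairing_eq T_eq)
  have rows: "(s has_sum (1 / of_real b * (\<Sum>k\<in>?J. A k))) UNIV"
    unfolding s_def by (intro has_sum_cmult_right has_sum_finite_sum A_sum) simp
  have "(\<lambda>(n, m). X n m) summable_on UNIV \<times> UNIV"
  proof (rule summable_on_SigmaI)
    show "((\<lambda>m. case (n, m) of (n, m) \<Rightarrow> X n m) has_sum Re (s n)) UNIV" for n
      using has_sum_Re[OF row[of n]] by simp
    show "(\<lambda>n. Re (s n)) summable_on UNIV"
      using has_sum_Re[OF rows] by (rule has_sum_imp_summable)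
  qed (simp add: X_def)
  then have X_sum: "((\<lambda>(n, m). X n m) has_sum (\<Sum>\<^sub>\<infinity>(n, m). X n m)) (UNIV \<times> UNIV)"
    by simp
  have "((\<lambda>p. complex_of_real (case p of (n, m) \<Rightarrow> X n m)) has_sum
      (1 / of_real b * (\<Sum>k\<in>?J. A k))) (UNIV \<times> UNIV)"
  proof (rule has_sum_SigmaI[OF _ rows])
    show "((\<lambda>m. complex_of_real (case (n, m) of (n, m) \<Rightarrow> X n m)) has_sum s n) UNIV" for n
      using row[of n] by simp
    show "(\<lambda>p. complex_of_real (case p of (n, m) \<Rightarrow> X n m)) summable_on UNIV \<times> UNIV"
      by (rule has_sum_imp_summable[OF has_sum_of_real[OF X_sum]])
  qed
  then have total: "complex_of_real (\<Sum>\<^sub>\<infinity>(n, m). X n m) = 1 / of_real b * (\<Sum>k\<in>?J. A k)"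
    by (rule has_sum_unique[OF has_sum_of_real[OF X_sum]])
  have swapped: "((\<lambda>(m, n). X n m) has_sum (\<Sum>\<^sub>\<infinity>(n, m). X n m)) UNIV"
    using iffD1[OF has_sum_swap X_sum] by simp

  show ?thesis
    unfolding WH_frame_identity_holds_def
  proof (intro conjI allI)
    show "integrable lebesgue (\<lambda>x. f x * cnj (WH_atom g a b m n x))" for m n
      unfolding atom_eq
      by (rule Bochner_Integration.integrable_bound[OF int_h[of n]]) (simp_all add: norm_mult harmonic_cnj)
    show "AE t in lebesgue. f_product f b k t \<noteq> 0 \<longrightarrow>
        Infinite_Sum.abs_summable_on (G_term g a b k t) UNIV" for k
      using T_sum(1)[of k]
    proof eventually_elim
      case (elim t)
      then show ?case
        by (auto simp: T_def norm_mult summable_on_cmult_right')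
    qed
    show "integrable lebesgue (\<lambda>t. f_product f b k t * G g a b k t)" for k
      using T_sum(2)[of k] by (simp only: infsum_T)
    show "(\<lambda>(m, n). (cmod (pairing f (WH_atom g a b m n)))\<^sup>2) summable_on UNIV"
      using has_sum_imp_summable[OF swapped] by (simp only: X_def)
    show "(\<lambda>k. \<integral>t. f_product f b k t * G g a b k t \<partial>lebesgue) summable_on UNIV"
      using has_sum_imp_summable[OF A_has_sum] by (simp only: A_def[abs_def])
    show "complex_of_real (\<Sum>\<^sub>\<infinity>(m, n)\<in>UNIV. (cmod (pairing f (WH_atom g a b m n)))\<^sup>2) =
       1 / complex_of_real b * (\<Sum>\<^sub>\<infinity>k\<in>UNIV. \<integral>t. f_product f b k t * G g a b k t \<partial>lebesgue)"
      using total infsumI[OF swapped] infsumI[OF A_has_sum] by (simp only: X_def A_def[abs_def])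
  qed
qed

section \<open>The converse\<close>

text \<open>The line is the disjoint union of the translates of \<open>[0, a)\<close> by multiples of \<open>a\<close>. The sum over the
  integers is written as a series along \<open>int_decode\<close>, so that monotone convergence for series applies.\<close>

lemma nn_integral_unfold_periods:
  fixes a :: real
  assumes a: "a > 0" and [measurable]: "\<phi> \<in> borel_measurable lebesgue"
  shows "(\<integral>\<^sup>+t. \<phi> t \<partial>lebesgue)
       = (\<integral>\<^sup>+t. indicator {0..<a} t * (\<Sum>i. \<phi> (t - of_int (int_decode i) * a)) \<partial>lebesgue)"
proof -
  have b: "1/a > 0"
    using a by simp
  define Q where "Q i = {t. t + of_int (int_decode i) * a \<in> {0..<a}}" for i
  have Q_iff: "t \<in> Q i \<longleftrightarrow> i = int_encode (- \<lfloor>t * (1/a)\<rfloor>)" for t i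
  proof -
    have "t \<in> Q i \<longleftrightarrow> int_decode i = - \<lfloor>t * (1/a)\<rfloor>"
      unfolding Q_def mem_Collect_eq
      using period_cell_iff_floor[OF b, of t "int_decode i"] by simp
    then show ?thesis
      by (metis int_decode_inverse int_encode_inverse)
  qed
  have cover: "(\<Sum>i. indicator (Q i) t * \<phi> t) = \<phi> t" for t
  proof -
    have "disjoint_family Q"
      by (auto simp: disjoint_family_on_def Q_iff)
    moreover have "t \<in> Q (int_encode (- \<lfloor>t * (1/a)\<rfloor>))"
      by (simp add: Q_iff)
    ultimately show ?thesis
      using suminf_cmult_indicator[of Q t _ "\<lambda>_. \<phi> t"] by (simp add: mult.commute)
  qed
  have shift_meas [measurable]: "(\<lambda>t. \<phi> (t - c)) \<in> borel_measurable lebesgue" for c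
    by (rule lebesgue_measurable_translate) measurable
  have ind: "indicator (Q i) (t - of_int (int_decode i) * a) = (indicator {0..<a} t :: ennreal)" for i t
    by (simp add: Q_def indicator_def)
  have "Q i = {- of_int (int_decode i) * a ..< a - of_int (int_decode i) * a}" for i
    by (auto simp: Q_def)
  then have Q_meas [measurable]: "Q i \<in> sets lebesgue" for i
    by simp
  have "(\<integral>\<^sup>+t. \<phi> t \<partial>lebesgue) = (\<integral>\<^sup>+t. (\<Sum>i. indicator (Q i) t * \<phi> t) \<partial>lebesgue)"
    by (simp only: cover)
  also have "\<dots> = (\<Sum>i. \<integral>\<^sup>+t. indicator (Q i) t * \<phi> t \<partial>lebesgue)"
    by (rule nn_integral_suminf) measurable
  also have "\<dots> = (\<Sum>i. \<integral>\<^sup>+t. indicator {0..<a} t * \<phi> (t - of_int (int_decode i) * a) \<partial>lebesgue)"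
  proof (rule suminf_cong)
    fix i
    have "(\<lambda>t. indicator (Q i) t * \<phi> t) \<in> borel_measurable lebesgue"
      by measurable
    from nn_integral_translate[OF this, of "of_int (int_decode i) * a"]
    show "(\<integral>\<^sup>+t. indicator (Q i) t * \<phi> t \<partial>lebesgue)
        = (\<integral>\<^sup>+t. indicator {0..<a} t * \<phi> (t - of_int (int_decode i) * a) \<partial>lebesgue)"
      by (simp only: ind)
  qed
  also have "\<dots> = (\<integral>\<^sup>+t. (\<Sum>i. indicator {0..<a} t * \<phi> (t - of_int (int_decode i) * a)) \<partial>lebesgue)"
    by (rule nn_integral_suminf[symmetric])
       (intro borel_measurable_times_ennreal borel_measurable_indicator shift_meas, simp)
  also have "\<dots> = (\<integral>\<^sup>+t. indicator {0..<a} t * (\<Sum>i. \<phi> (t - of_int (int_decode i) * a)) \<partial>lebesgue)"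
    by (simp only: ennreal_suminf_cmult)
  finally show ?thesis .
qed

text \<open>The product of the indicator \<open>f\<close> with itself at shift \<open>k = 0\<close> is again the indicator, so
  integrability of the term \<open>k = 0\<close> says that \<open>G g a b 0\<close>, the periodization of \<open>|g|\<^sup>2\<close>, is
  integrable over \<open>[0, a)\<close>. By unfolding, this integral is \<open>\<integral> |g|\<^sup>2\<close>. The pointwise summability is
  needed as well: where the series diverges, \<open>G\<close> has the default value \<open>0\<close>, which says nothing about \<open>g\<close>.\<close>

lemma L2_of_WH_frame_identity:
  assumes a: "a > 0" and g [measurable]: "g \<in> borel_measurable lebesgue"
    and id: "WH_frame_identity_holds g a b (indicator {0..<a})"
  shows "g \<in> L2_functions"
proof -
  let ?f = "indicator {0..<a} :: real \<Rightarrow> complex"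
  let ?S = "\<lambda>t. \<Sum>i. ennreal ((cmod (g (t - of_int (int_decode i) * a)))\<^sup>2)"
  have fp: "f_product ?f b 0 t = ?f t" for t
    by (simp add: f_product_def indicator_def)
  have term_eq: "G_term g a b 0 t n = of_real ((cmod (g (t - of_int n * a)))\<^sup>2)" for t n
    by (simp only: G_term_def complex_norm_square) simp
  have int: "integrable lebesgue (\<lambda>t. ?f t * G g a b 0 t)"
    using id[unfolded WH_frame_identity_holds_def, THEN conjunct2, THEN conjunct2, THEN conjunct1,
        rule_format, of 0] by (simp only: fp)
  have "AE t in lebesgue. f_product ?f b 0 t \<noteq> 0 \<longrightarrow>
      Infinite_Sum.abs_summable_on (G_term g a b 0 t) UNIV"
    using id[unfolded WH_frame_identity_holds_def, THEN conjunct2, THEN conjunct1] by (rule spec)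
  then have le: "AE t in lebesgue. indicator {0..<a} t * ?S t \<le> ennreal (norm (?f t * G g a b 0 t))"
  proof eventually_elim
    case (elim t)
    show ?case
    proof (cases "t \<in> {0..<a}")
      case True
      \<comment> \<open>Here the three forms of the sum agree: over the integers, as a sequence, and in \<open>[0, \<infinity>]\<close>.\<close>
      define x where "x n = (cmod (g (t - of_int n * a)))\<^sup>2" for n :: int
      have "x summable_on UNIV"
        using elim True by (simp add: fp term_eq x_def[abs_def] del: of_real_power)
      then have sum: "(x has_sum infsum x UNIV) UNIV"
        by simp
      then have "((\<lambda>i. x (int_decode i)) has_sum infsum x UNIV) UNIV"
        by (subst has_sum_reindex_bij_betw[OF bij_int_decode])
      then have "(\<lambda>i. x (int_decode i)) sums infsum x UNIV"
        by (rule has_sum_imp_sums)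
      then have "(\<Sum>i. ennreal (x (int_decode i))) = ennreal (infsum x UNIV)"
        by (intro suminf_ennreal_eq) (simp add: x_def)
      moreover have "G g a b 0 t = of_real (infsum x UNIV)"
        unfolding G_def term_eq x_def[symmetric] by (rule infsumI[OF has_sum_of_real[OF sum]])
      moreover have "infsum x UNIV \<ge> 0"
        by (rule infsum_nonneg) (simp add: x_def)
      ultimately show ?thesis
        using True by (simp add: x_def)
    qed simp
  qed
  have g2_meas: "(\<lambda>t. ennreal ((cmod (g t))\<^sup>2)) \<in> borel_measurable lebesgue"
    by measurable
  have "(\<integral>\<^sup>+t. ennreal ((cmod (g t))\<^sup>2) \<partial>lebesgue) = (\<integral>\<^sup>+t. indicator {0..<a} t * ?S t \<partial>lebesgue)"
    by (rule nn_integral_unfold_periods[OF a g2_meas])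
  also have "\<dots> \<le> (\<integral>\<^sup>+t. ennreal (norm (?f t * G g a b 0 t)) \<partial>lebesgue)"
    by (rule nn_integral_mono_AE[OF le])
  also have "\<dots> < \<infinity>"
    using int by (simp add: integrable_iff_bounded)
  finally have "integrable lebesgue (\<lambda>t. (cmod (g t))\<^sup>2)"
    by (simp add: integrable_iff_bounded)
  then show ?thesis
    using g by (simp add: L2_functions_def)
qed

lemma bounded_compactly_supported_indicator:
  "bounded_compactly_supported (indicator {0..<a::real})"
proof -
  have "support_on UNIV (indicator {0..<a} :: real \<Rightarrow> complex) \<subseteq> {0..<a}"
    by (auto simp: support_on_def indicator_def)
  then have "bounded (support_on UNIV (indicator {0..<a} :: real \<Rightarrow> complex))"
    by (rule bounded_subset[rotated]) simp
  moreover have "bounded (range (indicator {0..<a} :: real \<Rightarrow> complex))"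
    by (rule bounded_subset[of "{0, 1}"]) (auto simp: indicator_def)
  ultimately show ?thesis
    by (simp add: bounded_compactly_supported_def compact_closure borel_measurable_indicator)
qed

theorem theorem3p3:
  fixes a b :: real and g :: "real \<Rightarrow> complex"
  assumes "a > 0" and "b > 0"
    and "g \<in> borel_measurable lebesgue"
  shows "g \<in> L2_functions \<longleftrightarrow>
         (\<forall>f. bounded_compactly_supported f \<longrightarrow> WH_frame_identity_holds g a b f)"
  using WH_frame_identity_of_L2[OF assms(1,2)] L2_of_WH_frame_identity[OF assms(1,3)]
    bounded_compactly_supported_indicator
  by blast

end
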